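(* Let $n\ge 1$ be an odd integer and let $m=2\prod_{i=1}^s p_i^{\alpha_i}$, where $s\ge 1$, $p_1<p_2<\cdots<p_s$ are odd primes and all $\alpha_i$ are positive integers. (a) If $s=1$, then there is no $(m,n)$-generalized bent function if one of the following conditions is satisfied: (i) $p_1>2^{n-2}$; (ii) $p_1$ is not a Mersenne prime and $p_1>2^{n-3}$; (iii) $p_1\equiv 3$ or $5\pmod 8$. (b) If $s\ge 2$, and $r$ is the least integer with $0\le r\le s-1$ such that $p_{r+1}+p_1>2^n+2$, then there is no $(m,n)$-generalized bent function if there is no $\left(2\prod_{i=1}^r p_i^{\alpha_i},n\right)$-generalized bent function. In particular, (for $s\ge 2$) there is no $(m,n)$-generalized bent function if $p_1>2^{n-2}$ and $p_1+p_2>2^n+2$.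
   Context: For integers $m\ge 2$ and $n\ge 1$, put $\zeta_m=e^{2\pi\sqrt{-1}/m}$. A function $f:\mathbb{Z}_2^n\to\mathbb{Z}_m$ (where $\mathbb{Z}_m=\mathbb{Z}/m\mathbb{Z}$) is called an $(m,n)$-generalized bent function ($(m,n)$-GBF) if $|F(y)|^2=2^n$ for all $y\in\mathbb{Z}_2^n$, where $F(y)=\sum_{x\in\mathbb{Z}_2^n}\zeta_m^{f(x)}(-1)^{y\cdot x}$ and $y\cdot x$ is the usual inner product. A Mersenne prime is a prime of the form $2^k-1$. The empty product (for $r=0$) equals $1$. *)

theory Defs
  imports "HOL-Number_Theory.Residues" Complex_Main
begin

text \<open>
  \<open>\<int>\<^sub>m\<close> is the carrier \<open>{0..m-1}\<close> of the library's \<^const>\<open>residue_ring\<close>; a vector of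
  \<open>\<int>\<^sub>2\<^sup>n\<close> is an extensional function on the index set \<open>{..<n}\<close>, so that equal vectors are
  equal functions and \<open>\<int>\<^sub>2\<^sup>n\<close> has exactly \<open>2\<^sup>n\<close> elements.
\<close>

definition Z2_vec :: "nat \<Rightarrow> (nat \<Rightarrow> int) set" where
  "Z2_vec n = {..<n} \<rightarrow>\<^sub>E carrier (residue_ring 2)"

definition Z2_inner :: "nat \<Rightarrow> (nat \<Rightarrow> int) \<Rightarrow> (nat \<Rightarrow> int) \<Rightarrow> int" where
  "Z2_inner n y x = (\<Sum>i<n. y i * x i) mod 2"

definition zeta :: "nat \<Rightarrow> complex" where
  "zeta m = exp (2 * of_real pi * \<i> / of_nat m)"

definition gbf_transform :: "nat \<Rightarrow> nat \<Rightarrow> ((nat \<Rightarrow> int) \<Rightarrow> int) \<Rightarrow> (nat \<Rightarrow> int) \<Rightarrow> complex" where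
  "gbf_transform m n f y = (\<Sum>x\<in>Z2_vec n. zeta m powi f x * (-1) powi Z2_inner n y x)"

text \<open>
  The notion is meant for \<open>m \<ge> 2\<close> and \<open>n \<ge> 1\<close>. Values of \<open>f\<close> outside \<open>\<int>\<^sub>2\<^sup>n\<close> play no role.
\<close>

definition generalized_bent :: "nat \<Rightarrow> nat \<Rightarrow> ((nat \<Rightarrow> int) \<Rightarrow> int) \<Rightarrow> bool" where
  "generalized_bent m n f \<longleftrightarrow>
     f \<in> Z2_vec n \<rightarrow> carrier (residue_ring (int m)) \<and>
     (\<forall>y\<in>Z2_vec n. (cmod (gbf_transform m n f y))\<^sup>2 = 2 ^ n)"

definition mersenne_prime :: "nat \<Rightarrow> bool" where
  "mersenne_prime q \<longleftrightarrow> prime q \<and> (\<exists>k. q = 2 ^ k - 1)"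

end

theory Submission
  imports Defs "HOL-Computational_Algebra.Polynomial_Factorial"
begin

text \<open>
  By Fourier inversion \<open>f\<close> is generalized bent iff all nontrivial autocorrelations of \<open>\<zeta>\<^sub>m\<^sup>f\<close> vanish.
  These are vanishing sums of \<open>2\<^sup>n\<close> roots of unity of order dividing \<open>m\<close>. If the exact power \<open>p\<^sup>\<alpha>\<close> divides
  \<open>m\<close> and \<open>p\<close> plus the least odd prime factor exceeds \<open>2\<^sup>n + 2\<close>, such a sum (being of even length) still
  vanishes after its \<open>p\<close>-part is discarded, so that \<open>f\<close> projects to a generalized bent function of modulus
  \<open>m / p\<^sup>\<alpha>\<close>; this gives (b).

  For \<open>m = 2p\<^sup>\<alpha>\<close> the autocorrelations of the Boolean sign \<open>(-1)\<^sup>f\<close> are divisible by \<open>p\<close>, and by 4. If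
  \<open>4p > 2\<^sup>n\<close> they all vanish, whence \<open>2\<^sup>n\<close> is the square of an integer. If \<open>4p \<le> 2\<^sup>n < 8p\<close>, they all vanish or
  they are all \<open>\<plusminus>4p\<close>, and counting values of the Walsh transform modulo \<open>2p\<close> forces \<open>p = 2\<^sup>n\<^sup>-\<^sup>2 - 1\<close>. If \<open>p\<close> is
  3 or 5 modulo 8, some power of 2 is \<open>-1\<close> modulo \<open>p\<^sup>\<alpha>\<close>, so no element of \<open>\<int>[\<zeta>\<^sub>m]\<close> has squared modulus \<open>2\<^sup>n\<close>
  with \<open>n\<close> odd.
\<close>

section \<open>Values of integer polynomials at roots of unity\<close>

text \<open>For fixed \<open>z\<close> the values \<open>ev Q z\<close> form the ring Z[z]. Its
  elements are handled through polynomial representatives, so that conjugations and Frobenius maps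
  become substitutions for \<open>z\<close>.\<close>

definition ev :: "int poly \<Rightarrow> complex \<Rightarrow> complex" where
  "ev Q z = poly (map_poly of_int Q) z"

lemma ev_0 [simp]: "ev 0 z = 0"
  by (simp add: ev_def)

lemma ev_pCons [simp]: "ev (pCons a Q) z = of_int a + z * ev Q z"
  by (simp add: ev_def map_poly_pCons)

lemma ev_1 [simp]: "ev 1 z = 1"
  by (simp add: one_pCons)

lemma ev_add [simp]: "ev (P + Q) z = ev P z + ev Q z"
  by (induction P Q rule: poly_induct2) (auto simp: algebra_simps)

lemma ev_smult [simp]: "ev (smult a Q) z = of_int a * ev Q z"
  by (induction Q) (auto simp: algebra_simps)

lemma ev_minus [simp]: "ev (- Q) z = - ev Q z"
  using ev_smult[of "-1" Q z] by simp

lemma ev_diff [simp]: "ev (P - Q) z = ev P z - ev Q z"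
  using ev_add[of P "- Q" z] by simp

lemma ev_mult [simp]: "ev (P * Q) z = ev P z * ev Q z"
  by (induction P) (auto simp: algebra_simps)

lemma ev_power [simp]: "ev (Q ^ k) z = ev Q z ^ k"
  by (induction k) auto

lemma ev_monom [simp]: "ev (monom a k) z = of_int a * z ^ k"
  by (induction k) (auto simp: monom_Suc monom_0)

lemma ev_of_int [simp]: "ev (of_int a) z = of_int a"
  by (simp add: of_int_poly)

lemma ev_of_nat [simp]: "ev (of_nat a) z = of_nat a"
  using ev_of_int[of "int a" z] by simp

lemma ev_sum [simp]: "ev (\<Sum>x\<in>X. Q x) z = (\<Sum>x\<in>X. ev (Q x) z)"
  by (induction X rule: infinite_finite_induct) auto

lemma ev_pcompose [simp]: "ev (pcompose Q R) z = ev Q (ev R z)"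
  by (induction Q) (auto simp: pcompose_pCons)

lemma cnj_ev: "cnj (ev Q z) = ev Q (cnj z)"
  by (induction Q) auto

text \<open>A polynomial of least degree vanishing at \<open>z\<close>, made primitive, divides all
  others by pseudo-division and Gauss's lemma. As it divides X^m - 1, its leading coefficient is a
  unit.\<close>

lemma root_of_unity_minimal_poly:
  fixes z :: complex
  assumes "z ^ m = 1" "m > 0"
  obtains f :: "int poly" where "lead_coeff f = 1" "degree f > 0" "ev f z = 0"
    "\<And>Q. ev Q z = 0 \<Longrightarrow> f dvd Q"
proof -
  define P where "P f \<longleftrightarrow> f \<noteq> 0 \<and> ev f z = 0" for f
  define u :: "int poly" where "u = monom 1 m - 1"
  have lcu: "lead_coeff u = 1" "degree u = m"
  proof -
    have "degree u = degree (monom (1::int) m)"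
      unfolding u_def diff_conv_add_uminus using assms(2)
      by (intro degree_add_eq_left) (simp add: degree_monom_eq)
    then show "degree u = m" by (simp add: degree_monom_eq)
    then show "lead_coeff u = 1" using assms(2) by (simp add: u_def)
  qed
  have evu: "ev u z = 0" using assms by (simp add: u_def)
  have "P u" using lcu evu by (auto simp: P_def)
  then obtain g where g: "P g" "\<And>h. P h \<Longrightarrow> degree g \<le> degree h"
    using ex_has_least_nat[of P u degree] by blast
  define f where "f = primitive_part g"
  have g0: "g \<noteq> 0" "ev g z = 0" using g by (auto simp: P_def)
  have "ev g z = of_int (content g) * ev f z"
    unfolding f_def by (metis content_times_primitive_part ev_smult)
  then have evf: "ev f z = 0" using g0 by simp
  have f0: "f \<noteq> 0" using g0 by (simp add: f_def)
  have cf: "content f = 1" using g0 by (simp add: f_def)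
  have degf: "degree f \<le> degree h" if "P h" for h
    using g(2)[OF that] by (simp add: f_def)
  have dvd: "f dvd Q" if "ev Q z = 0" for Q
  proof -
    \<comment> \<open>Pseudo-division costs a factor \<open>a\<close>; since \<open>f\<close> has
      content 1, \<open>a\<close> divides the content of the quotient and cancels.\<close>
    obtain a q where aq: "a \<noteq> 0" "smult a Q = f * q + pseudo_mod Q f"
      using pseudo_mod(1)[OF f0, of Q] by blast
    have d: "pseudo_mod Q f = 0 \<or> degree (pseudo_mod Q f) < degree f"
      using pseudo_mod(2)[OF f0, of Q] by blast
    have "ev (smult a Q) z = ev (f * q + pseudo_mod Q f) z" using aq by simp
    then have "ev (pseudo_mod Q f) z = 0" using that evf by simp
    with d degf[of "pseudo_mod Q f"] have "pseudo_mod Q f = 0"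
      unfolding P_def by force
    with aq have e: "smult a Q = f * q" by simp
    then have "content q = content (smult a Q)"
      by (simp add: content_mult cf)
    then have "a dvd content q" by simp
    then have "[:a:] dvd q" by (simp add: const_poly_dvd_iff_dvd_content)
    then obtain r where "q = smult a r" by (auto simp: dvd_def)
    with e have "smult a Q = smult a (f * r)" by simp
    then have "smult a (Q - f * r) = 0" by (simp add: smult_diff_right)
    then have "Q = f * r" using aq(1) by simp
    then show ?thesis by simp
  qed
  obtain h where h: "u = f * h" using dvd[OF evu] by (auto simp: dvd_def)
  then have "lead_coeff f * lead_coeff h = 1"
    using lcu by (simp add: lead_coeff_mult)
  then have l: "lead_coeff f = 1 \<or> lead_coeff f = -1"
    by (rule pos_zmult_eq_1_iff_lemma)
  have dpos: "degree f > 0"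
  proof (rule ccontr)
    assume "\<not> degree f > 0"
    then obtain a where "f = [:a:]" by (metis degree_eq_zeroE gr0I)
    with evf f0 show False by simp
  qed
  show thesis
  proof (cases "lead_coeff f = 1")
    case True
    then show ?thesis using that dpos evf dvd by blast
  next
    case False
    with l have "lead_coeff (- f) = 1" by simp
    then show ?thesis using that[of "- f"] dpos evf dvd by simp
  qed
qed

text \<open>After reduction of \<open>H\<close> modulo the monic minimal polynomial to
  \<open>B\<close>, the polynomial \<open>c - q B\<close> vanishes at \<open>z\<close> but has
  smaller degree, so it is 0. This brings congruences in Z[z] down to the integers.\<close>

lemma int_dvd_if_eq_mult_ev:
  fixes z :: complex
  assumes "z ^ m = 1" "m > 0" "of_int c = of_int q * ev H z"
  shows "q dvd c"
proof -
  obtain f :: "int poly" where f: "lead_coeff f = 1" "degree f > 0" "ev f z = 0"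
    "\<And>Q. ev Q z = 0 \<Longrightarrow> f dvd Q"
    using root_of_unity_minimal_poly[OF assms(1,2)] by blast
  have f0: "f \<noteq> 0" using f by auto
  define B where "B = pseudo_mod H f"
  obtain A where HA: "H = f * A + B" and B: "B = 0 \<or> degree B < degree f"
  proof -
    obtain A r where 1: "pseudo_divmod H f = (A, r)" by (cases "pseudo_divmod H f")
    from pseudo_divmod[OF f0 1] f(1) have "H = f * A + r" "r = 0 \<or> degree r < degree f"
      by auto
    moreover have "r = B" using 1 by (simp add: B_def pseudo_mod_def)
    ultimately show thesis using that by blast
  qed
  have "ev H z = ev B z" using HA f by simp
  then have "ev ([:c:] - smult q B) z = 0" using assms(3) by simp
  then have "f dvd [:c:] - smult q B" by (rule f)
  moreover have "degree ([:c:] - smult q B) < degree f"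
    using B f(2) by (intro degree_diff_less) (auto simp: degree_smult_eq)
  ultimately have "[:c:] - smult q B = 0"
    using f0 by (meson dvd_imp_degree_le leD)
  then have "c = q * coeff B 0"
    by (metis coeff_pCons_0 coeff_smult eq_iff_diff_eq_0)
  then show ?thesis by simp
qed

section \<open>Frobenius congruences\<close>

lemma freshman_dvd:
  fixes a b :: "'a :: comm_ring_1"
  assumes "prime q"
  shows "of_nat q dvd (a + b) ^ q - (a ^ q + b ^ q)"
proof -
  have q: "q > 0" using assms prime_gt_0_nat by blast
  have "(a + b) ^ q = (\<Sum>k\<le>q. of_nat (q choose k) * a ^ k * b ^ (q - k))"
    by (rule binomial_ring)
  also have "{..q} = insert 0 (insert q {1..<q})" using q by auto
  also have "(\<Sum>k\<in>\<dots>. of_nat (q choose k) * a ^ k * b ^ (q - k)) =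
      b ^ q + a ^ q + (\<Sum>k\<in>{1..<q}. of_nat (q choose k) * a ^ k * b ^ (q - k))"
    using q by simp
  finally have "(a + b) ^ q - (a ^ q + b ^ q) =
      (\<Sum>k\<in>{1..<q}. of_nat (q choose k) * a ^ k * b ^ (q - k))" by simp
  moreover have "of_nat q dvd (of_nat (q choose k) * a ^ k * b ^ (q - k) :: 'a)"
    if "k \<in> {1..<q}" for k
  proof -
    have "q dvd q choose k"
      by (rule dvd_choose_prime) (use assms that in auto)
    then have "of_nat q dvd (of_nat (q choose k) :: 'a)"
      by (metis dvd_def of_nat_mult)
    then show ?thesis by (simp add: mult.assoc)
  qed
  ultimately show ?thesis by (auto intro: dvd_sum)
qed

lemma prime_dvd_power_diff_int:
  fixes a :: int
  assumes "prime q"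
  shows "int q dvd a ^ q - a"
proof -
  have nat: "int q dvd int n ^ q - int n" for n
  proof (induction n)
    case 0
    then show ?case using prime_gt_0_nat[OF assms] by (simp add: power_0_left)
  next
    case (Suc n)
    have "int q dvd (int n + 1) ^ q - (int n ^ q + 1 ^ q)"
      using freshman_dvd[OF assms, of "int n" 1] by simp
    from dvd_add[OF this Suc] show ?case by (simp add: algebra_simps)
  qed
  have "int (nat (a mod int q)) = a mod int q"
    using prime_gt_0_nat[OF assms] by simp
  then have "[a = int (nat (a mod int q))] (mod int q)"
    by (simp add: cong_def)
  then have "[a ^ q - a = int (nat (a mod int q)) ^ q - int (nat (a mod int q))] (mod int q)"
    by (intro cong_diff cong_pow)
  with nat show ?thesis by (meson cong_dvd_iff)
qed

text \<open>Writing \<open>pCons a Q\<close> as a + X Q, the binomial congruence separates the two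
  summands; Fermat's little theorem handles \<open>a\<close> and the induction hypothesis handles
  \<open>Q\<close>.\<close>

lemma frobenius_poly_dvd:
  fixes Q :: "int poly"
  assumes "prime q"
  shows "of_nat q dvd Q ^ q - pcompose Q (monom 1 q)"
proof (induction Q)
  case 0
  then show ?case using prime_gt_0_nat[OF assms] by (simp add: power_0_left)
next
  case (pCons a Q)
  let ?X = "monom (1::int) 1"
  have e: "pCons a Q = [:a:] + ?X * Q"
    by (simp add: monom_altdef)
  have "of_nat q dvd (pCons a Q) ^ q - ([:a:] ^ q + (?X * Q) ^ q)"
    unfolding e by (rule freshman_dvd[OF assms])
  moreover have "of_nat q dvd [:a:] ^ q - [:a:]"
  proof -
    have "[:a:] ^ q - [:a:] = of_int (a ^ q - a)"
      by (simp add: of_int_poly poly_const_pow)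
    then show ?thesis
      using prime_dvd_power_diff_int[OF assms, of a] by (metis dvd_def of_int_mult of_int_of_nat_eq)
  qed
  moreover have "of_nat q dvd ?X ^ q * (Q ^ q - pcompose Q (monom 1 q))"
    using pCons by simp
  ultimately have "of_nat q dvd ((pCons a Q) ^ q - ([:a:] ^ q + (?X * Q) ^ q)) + ([:a:] ^ q - [:a:])
      + ?X ^ q * (Q ^ q - pcompose Q (monom 1 q))"
    by (intro dvd_add)
  also have "\<dots> = (pCons a Q) ^ q - pcompose (pCons a Q) (monom 1 q)"
    by (simp add: pcompose_pCons algebra_simps power_mult_distrib monom_power)
  finally show ?case .
qed

lemma pcompose_monom_monom:
  "pcompose (monom 1 a) (monom 1 b) = monom (1 :: 'a :: comm_semiring_1) (a * b)"
  by (induction a) (simp_all add: monom_Suc pcompose_pCons mult_monom pcompose_1)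

lemma frobenius_power_poly_dvd:
  fixes Q :: "int poly"
  assumes "prime q"
  shows "of_nat q dvd Q ^ (q ^ i) - pcompose Q (monom 1 (q ^ i))"
proof (induction i)
  case 0
  then show ?case by (simp add: monom_altdef)
next
  case (Suc i)
  let ?R = "pcompose Q (monom 1 (q ^ i))"
  have "Q ^ (q ^ i) - ?R dvd (Q ^ (q ^ i)) ^ q - ?R ^ q"
    by (metis dvd_triv_left power_diff_sumr2)
  with Suc have "of_nat q dvd (Q ^ (q ^ i)) ^ q - ?R ^ q"
    by (rule dvd_trans)
  from dvd_add[OF this frobenius_poly_dvd[OF assms, of ?R]]
  show ?case
    by (simp add: power_mult [symmetric] mult.commute pcompose_assoc [symmetric] pcompose_monom_monom)
qed

lemma frobenius_ev:
  assumes "prime q"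
  obtains H where "ev Q z ^ (q ^ i) = ev Q (z ^ (q ^ i)) + of_nat q * ev H z"
proof -
  obtain H where "Q ^ (q ^ i) - pcompose Q (monom 1 (q ^ i)) = of_nat q * H"
    using frobenius_power_poly_dvd[OF assms] by (meson dvdE)
  then have "ev (Q ^ (q ^ i) - pcompose Q (monom 1 (q ^ i))) z = ev (of_nat q * H) z" by simp
  then show thesis by (intro that[of H]) (simp add: algebra_simps)
qed

section \<open>Galois conjugation of roots of unity\<close>

text \<open>Dedekind's argument for the irreducibility of cyclotomic polynomials: the minimal
  polynomial of \<open>z\<close> also vanishes at \<open>z ^ q\<close>, because X^m - 1 remains
  separable modulo \<open>q\<close>.\<close>

lemma galois_prime:
  fixes z :: complex
  assumes "z ^ m = 1" "m > 0" "prime q" "\<not> q dvd m" "ev Q z = 0"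
  shows "ev Q (z ^ q) = 0"
proof -
  obtain f :: "int poly" where f: "lead_coeff f = 1" "degree f > 0" "ev f z = 0"
    "\<And>Q. ev Q z = 0 \<Longrightarrow> f dvd Q"
    using root_of_unity_minimal_poly[OF assms(1,2)] by blast
  have "f dvd monom 1 m - 1" using assms by (intro f) simp
  then obtain h where h: "monom 1 m - 1 = f * h" by (auto simp: dvd_def)
  have "ev f (z ^ q) = 0"
  proof (rule ccontr)
    assume nz: "ev f (z ^ q) \<noteq> 0"
    have "ev (monom 1 m - 1) (z ^ q) = 0"
      using assms(1) by (simp flip: power_mult add: mult.commute[of q]) (simp add: power_mult)
    \<comment> \<open>The cofactor \<open>h\<close> must take over the root \<open>z ^ q\<close>; by
      Frobenius, \<open>q\<close> then divides the \<open>q\<close>-th power of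
      \<open>ev h z\<close>.\<close>
    with h nz have h0: "ev h (z ^ q) = 0" by simp
    obtain H where H: "ev h z ^ q = of_nat q * ev H z"
      using frobenius_ev[OF assms(3), where Q = h and i = 1 and z = z] h0 by auto
    \<comment> \<open>The derivative of X^m - 1 = f h at \<open>z\<close> exhibits m as a multiple
      of \<open>ev h z\<close>, so that \<open>q\<close> divides \<open>m ^ q\<close>.\<close>
    have "pderiv (monom 1 m - 1) = pderiv (f * h)" using h by simp
    then have "ev (monom (int m) (m - 1)) z = ev (f * pderiv h + h * pderiv f) z"
      by (simp add: pderiv_diff pderiv_monom pderiv_mult)
    then have "of_nat m * z ^ (m - 1) = ev h z * ev (pderiv f) z"
      using f by simp
    moreover have z: "z ^ (m - 1) * z = 1"
      using power_minus_mult[OF assms(2), of z] assms(1) by simp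
    have "of_nat m = of_nat m * z ^ (m - 1) * z"
      unfolding mult.assoc z by simp
    ultimately have "of_nat m = ev h z * ev (pderiv f) z * z"
      by metis
    then have "of_nat m ^ q = ev h z ^ q * (ev (pderiv f) z * z) ^ q"
      by (simp add: power_mult_distrib mult.assoc)
    also have "\<dots> = of_int (int q) * ev (H * (pderiv f * monom 1 1) ^ q) z"
      by (simp add: H)
    finally have "of_int (int m ^ q) = of_int (int q) * ev (H * (pderiv f * monom 1 1) ^ q) z"
      by simp
    then have "int q dvd int m ^ q"
      by (rule int_dvd_if_eq_mult_ev[OF assms(1,2)])
    then have "q dvd m"
      using assms(3) by (metis int_dvd_int_iff of_nat_power prime_dvd_power)
    with assms show False by simp
  qed
  moreover obtain g where "Q = f * g" using f(4)[OF assms(5)] by (auto simp: dvd_def)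
  ultimately show ?thesis by simp
qed

text \<open>One prime factor of \<open>k\<close> is split off at a time. The induction varies
  \<open>z\<close>, since each factor \<open>q\<close> replaces it by \<open>z ^ q\<close>.\<close>

lemma galois_coprime:
  fixes z :: complex
  assumes "z ^ m = 1" "m > 0" "coprime k m" "ev Q z = 0"
  shows "ev Q (z ^ k) = 0"
  using assms
proof (induction k arbitrary: z rule: less_induct)
  case (less k)
  consider "k = 0" | "k = 1" | "k > 1" by linarith
  then show ?case
  proof cases
    case 1
    with less.prems show ?thesis by simp
  next
    case 2
    with less.prems show ?thesis by simp
  next
    case 3
    then obtain q where q: "prime q" "q dvd k"
      using prime_factor_nat[of k] by auto
    then obtain l where l: "k = q * l" by (auto simp: dvd_def)
    have "l < k" using l 3 prime_gt_1_nat[OF q(1)] by (cases "l = 0") auto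
    moreover have "coprime q m" "coprime l m" using less.prems l by auto
    moreover have "\<not> q dvd m" using \<open>coprime q m\<close> q(1)
      by (metis coprime_absorb_left not_prime_unit)
    then have "ev Q (z ^ q) = 0" using galois_prime less.prems q by blast
    moreover have "(z ^ q) ^ m = 1" using less.prems
      by (metis mult.commute power_mult power_one)
    ultimately have "ev Q ((z ^ q) ^ l) = 0" using less by blast
    then show ?thesis by (simp add: l power_mult)
  qed
qed

section \<open>Vanishing sums of roots of unity\<close>

lemma power_nat_mod:
  fixes u :: complex
  assumes "u ^ m = 1" "m > 0"
  shows "u ^ nat (k mod int m) = u powi k"
proof -
  have u: "u \<noteq> 0" using assms by (auto simp: power_0_left)
  have "u powi k = u powi (int m * (k div int m) + k mod int m)" by simp
  also have "\<dots> = (u powi int m) powi (k div int m) * u powi (k mod int m)"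
    by (subst power_int_add) (use u in \<open>auto simp: power_int_mult\<close>)
  also have "\<dots> = u powi (k mod int m)" using assms by simp
  also have "\<dots> = u ^ nat (k mod int m)"
    using assms(2) by (simp add: power_int_def)
  finally show ?thesis by simp
qed

text \<open>Reducing the integer exponents to natural numbers below \<open>m\<close> makes a
  weighted sum of powers a polynomial value, simultaneously at every \<open>m\<close>-th root of
  unity.\<close>

definition fam_poly :: "nat \<Rightarrow> 'a set \<Rightarrow> ('a \<Rightarrow> int) \<Rightarrow> ('a \<Rightarrow> int) \<Rightarrow> int poly" where
  "fam_poly m X c e = (\<Sum>x\<in>X. monom (c x) (nat (e x mod int m)))"

lemma ev_fam_poly:
  assumes "u ^ m = 1" "m > 0"
  shows "ev (fam_poly m X c e) u = (\<Sum>x\<in>X. of_int (c x) * u powi e x)"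
  using assms by (simp add: fam_poly_def power_nat_mod)

lemma galois_family:
  fixes z :: complex
  assumes "z ^ m = 1" "m > 0" "coprime k (int m)" "(\<Sum>x\<in>X. z powi e x) = 0"
  shows "(\<Sum>x\<in>X. z powi (k * e x)) = 0"
proof -
  let ?k = "nat (k mod int m)"
  let ?Q = "fam_poly m X (\<lambda>_. 1) e"
  have "coprime (k mod int m) (int m)"
    using assms(2,3) by simp
  then have "coprime ?k m"
    using assms(2) by (metis coprime_int_iff int_nat_eq of_nat_0_less_iff pos_mod_sign)
  moreover have "ev ?Q z = 0" using assms by (simp add: ev_fam_poly)
  ultimately have "ev ?Q (z ^ ?k) = 0" using galois_coprime assms(1,2) by blast
  moreover have "(z ^ ?k) ^ m = 1"
    using assms(1) by (metis mult.commute power_mult power_one)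
  ultimately have "(\<Sum>x\<in>X. (z ^ ?k) powi e x) = 0"
    using assms(2) by (simp add: ev_fam_poly)
  moreover have "(z ^ ?k) powi i = z powi (k * i)" for i
    using power_nat_mod[OF assms(1,2), of k] by (simp add: power_int_mult)
  ultimately show ?thesis by simp
qed

lemma sum_powers_root_of_unity:
  fixes u :: complex
  assumes "u ^ M = 1"
  shows "(\<Sum>k<M. u ^ k) = (if u = 1 then of_nat M else 0)"
  using assms by (auto simp: geometric_sum)

text \<open>The sum over all \<open>k\<close> minus the sum over the multiples of \<open>p\<close>;
  both are geometric sums over a full period.\<close>

lemma ramanujan_sum_prime_power:
  fixes v :: complex
  assumes p: "prime p" and a: "\<alpha> > 0"
    and v: "\<And>d. v powi d = 1 \<longleftrightarrow> int (p ^ \<alpha>) dvd d"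
  shows "(\<Sum>k | k < p ^ \<alpha> \<and> \<not> p dvd k. v powi (int k * d)) =
    (if int (p ^ \<alpha>) dvd d then of_nat (p ^ \<alpha>) else 0) -
    (if int (p ^ (\<alpha> - 1)) dvd d then of_nat (p ^ (\<alpha> - 1)) else 0)"
proof -
  have pa: "p ^ \<alpha> = p * p ^ (\<alpha> - 1)" using a by (simp flip: power_Suc)
  have p0: "p > 0" using p prime_gt_0_nat by blast
  define u where "u = v powi d"
  have u: "v powi (int k * d) = u ^ k" for k
    by (simp add: u_def mult.commute[of _ d] power_int_mult)
  have uM: "u ^ (p ^ \<alpha>) = 1"
    by (simp only: u [symmetric] v) simp
  have u1: "u = 1 \<longleftrightarrow> int (p ^ \<alpha>) dvd d" by (simp add: u_def v)
  have up1: "u ^ p = 1 \<longleftrightarrow> int (p ^ (\<alpha> - 1)) dvd d"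
  proof -
    have "u ^ p = 1 \<longleftrightarrow> int p * int (p ^ (\<alpha> - 1)) dvd int p * d"
      by (simp only: u [symmetric] v pa of_nat_mult)
    then show ?thesis using p0 by simp
  qed
  have "(\<Sum>k<p ^ \<alpha>. u ^ k) = (\<Sum>k | k < p ^ \<alpha> \<and> \<not> p dvd k. u ^ k) + (\<Sum>k | k < p ^ \<alpha> \<and> p dvd k. u ^ k)"
    by (subst sum.union_disjoint [symmetric]) (auto intro!: sum.cong)
  moreover have "{k. k < p ^ \<alpha> \<and> p dvd k} = (\<lambda>l. p * l) ` {..<p ^ (\<alpha> - 1)}"
    using p0 by (auto simp: pa dvd_def)
  then have "(\<Sum>k | k < p ^ \<alpha> \<and> p dvd k. u ^ k) = (\<Sum>l<p ^ (\<alpha> - 1). (u ^ p) ^ l)"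
    using p0 by (simp add: sum.reindex inj_on_def power_mult)
  moreover have "(u ^ p) ^ (p ^ (\<alpha> - 1)) = 1"
    using uM by (simp add: pa flip: power_mult)
  ultimately have "(\<Sum>k | k < p ^ \<alpha> \<and> \<not> p dvd k. u ^ k) =
     (if u = 1 then of_nat (p ^ \<alpha>) else 0) - (if u ^ p = 1 then of_nat (p ^ (\<alpha> - 1)) else 0)"
    using sum_powers_root_of_unity[OF uM] sum_powers_root_of_unity[of "u ^ p" "p ^ (\<alpha> - 1)"]
    by (simp add: algebra_simps)
  then show ?thesis unfolding u u1 up1 .
qed

text \<open>
  With \<open>1 = N a + p\<^sup>\<alpha> b\<close> a root of unity \<open>z\<close> of order \<open>p\<^sup>\<alpha> N\<close> splits as the product of
  \<open>w = z powi (p\<^sup>\<alpha> b)\<close>, of order \<open>N\<close>, and \<open>v = z powi (N a)\<close>, of order \<open>p\<^sup>\<alpha>\<close>. Averaging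
  the conjugates that fix \<open>w\<close> gives the linear independence over \<open>\<rat>(w)\<close> of all but one
  element of each coset of the group of \<open>p\<close>-th roots of unity.
\<close>
lemma coset_sums_eq:
  fixes z :: complex
  assumes p: "prime p" and a: "\<alpha> > 0" and N: "N > 0" and cop: "coprime p N"
    and z: "\<And>d. z powi d = 1 \<longleftrightarrow> int (p ^ \<alpha> * N) dvd d"
    and fin: "finite X" and vanish: "(\<Sum>x\<in>X. z powi e x) = 0"
    and bez: "int N * a + int (p ^ \<alpha>) * b = 1"
    and w: "w = z powi (int (p ^ \<alpha>) * b)"
  shows "of_nat p * (\<Sum>x | x \<in> X \<and> [e x = j] (mod int (p ^ \<alpha>)). w powi e x) =
    (\<Sum>x | x \<in> X \<and> [e x = j] (mod int (p ^ (\<alpha> - 1))). w powi e x)"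
proof -
  let ?P = "int (p ^ \<alpha>)" and ?P' = "int (p ^ (\<alpha> - 1))"
  have p0: "p > 0" using p prime_gt_0_nat by blast
  have pa: "p ^ \<alpha> = p * p ^ (\<alpha> - 1)" using a by (simp flip: power_Suc)
  have m0: "p ^ \<alpha> * N > 0" using p0 N by simp
  have "z powi int (p ^ \<alpha> * N) = 1" by (simp only: z dvd_refl)
  then have zm: "z ^ (p ^ \<alpha> * N) = 1" by (simp only: power_int_of_nat)
  have z0: "z \<noteq> 0" using zm m0 by (auto simp: power_0_left)
  define v where "v = z powi (int N * a)"
  have v0: "v \<noteq> 0" using z0 by (simp add: v_def)
  have copaP: "coprime a ?P"
  proof (rule coprimeI)
    fix c assume "c dvd a" "c dvd ?P"
    then have "c dvd int N * a + ?P * b" by simp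
    then show "is_unit c" by (simp only: bez)
  qed
  have v: "v powi d = 1 \<longleftrightarrow> ?P dvd d" for d
  proof -
    have "v powi d = 1 \<longleftrightarrow> int (p ^ \<alpha> * N) dvd int N * a * d"
      by (simp only: v_def power_int_mult [symmetric] z)
    also have "\<dots> \<longleftrightarrow> int N * ?P dvd int N * (a * d)" by (simp add: mult_ac)
    also have "\<dots> \<longleftrightarrow> ?P dvd a * d" using N by simp
    also have "\<dots> \<longleftrightarrow> ?P dvd d"
      using copaP by (simp add: coprime_dvd_mult_right_iff coprime_commute)
    finally show ?thesis .
  qed
  have zk: "(\<Sum>x\<in>X. w powi e x * v powi (int k * e x)) = 0" if k: "\<not> p dvd k" for k
  proof -
    \<comment> \<open>By the Bezout identity, \<open>k'\<close> is 1 modulo \<open>N\<close> and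
      \<open>k\<close> modulo \<open>p ^ \<alpha>\<close>: raising to the power \<open>k'\<close>
      fixes \<open>w\<close> and sends \<open>v\<close> to its \<open>k\<close>-th power.\<close>
    define k' where "k' = ?P * b + int N * a * int k"
    have "coprime k' (int (p ^ \<alpha> * N))"
    proof -
      have "coprime k' (int N)"
      proof (rule coprimeI)
        fix c assume c: "c dvd k'" "c dvd int N"
        have "1 = k' - int N * (a * int k - a)" using bez by (simp add: k'_def algebra_simps)
        with c show "is_unit c" by (metis dvd_diff dvd_mult2)
      qed
      moreover have "coprime k' (int p)"
      proof -
        have "\<not> int p dvd k'"
        proof
          assume d: "int p dvd k'"
          have "int p dvd ?P" using a by simp
          with d have "int p dvd int N * a * int k"
            by (simp add: k'_def dvd_add_right_iff)
          moreover have "int N * a * int k = int k - ?P * b * int k"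
          proof -
            have "int N * a * int k + ?P * b * int k = (int N * a + ?P * b) * int k"
              by (simp only: distrib_right)
            then show ?thesis unfolding bez by simp
          qed
          ultimately have "int p dvd int k"
            using \<open>int p dvd ?P\<close> by (metis dvd_diff_left_iff dvd_mult2)
          with k show False by simp
        qed
        then show ?thesis using p by (metis coprime_commute prime_imp_coprime prime_nat_int_transfer)
      qed
      ultimately show ?thesis by simp
    qed
    then have "(\<Sum>x\<in>X. z powi (k' * e x)) = 0"
      using galois_family[OF zm m0] vanish by blast
    moreover have "z powi (k' * i) = w powi i * v powi (int k * i)" for i
      using z0 by (simp add: k'_def w v_def distrib_right power_int_add mult.assoc flip: power_int_mult)
    ultimately show ?thesis by simp
  qed
  let ?K = "{k. k < p ^ \<alpha> \<and> \<not> p dvd k}"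
  \<comment> \<open>Twisting each conjugate relation by the inverse of \<open>v powi (k * j)\<close>
    and summing over the units \<open>k\<close> isolates the class of \<open>j\<close>. The
    Ramanujan sums weight the class modulo \<open>p ^ \<alpha>\<close> against the coarser
    one.\<close>
  have "0 = (\<Sum>k\<in>?K. v powi (- (int k * j)) * (\<Sum>x\<in>X. w powi e x * v powi (int k * e x)))"
    by (simp add: zk)
  also have "\<dots> = (\<Sum>k\<in>?K. \<Sum>x\<in>X. w powi e x * v powi (int k * (e x - j)))"
    using v0 by (simp add: sum_distrib_left right_diff_distrib power_int_diff power_int_minus divide_inverse mult_ac)
  also have "\<dots> = (\<Sum>x\<in>X. w powi e x * (\<Sum>k\<in>?K. v powi (int k * (e x - j))))"
    by (subst sum.swap) (simp add: sum_distrib_left)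
  also have "\<dots> = (\<Sum>x\<in>X. w powi e x * (if ?P dvd e x - j then of_nat (p ^ \<alpha>) else 0)) -
      (\<Sum>x\<in>X. w powi e x * (if ?P' dvd e x - j then of_nat (p ^ (\<alpha> - 1)) else 0))"
    unfolding ramanujan_sum_prime_power[OF p a v] by (simp only: right_diff_distrib sum_subtractf)
  also have "(\<Sum>x\<in>X. w powi e x * (if ?P dvd e x - j then of_nat (p ^ \<alpha>) else 0)) =
      of_nat (p ^ \<alpha>) * (\<Sum>x | x \<in> X \<and> [e x = j] (mod ?P). w powi e x)"
    using fin by (simp add: sum.inter_filter sum_distrib_left cong_iff_dvd_diff mult_ac if_distrib cong: if_cong)
  also have "(\<Sum>x\<in>X. w powi e x * (if ?P' dvd e x - j then of_nat (p ^ (\<alpha> - 1)) else 0)) =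
      of_nat (p ^ (\<alpha> - 1)) * (\<Sum>x | x \<in> X \<and> [e x = j] (mod ?P'). w powi e x)"
    using fin by (simp add: sum.inter_filter sum_distrib_left cong_iff_dvd_diff mult_ac if_distrib cong: if_cong)
  finally have "of_nat (p ^ (\<alpha> - 1)) * (of_nat p * (\<Sum>x | x \<in> X \<and> [e x = j] (mod ?P). w powi e x)) =
      of_nat (p ^ (\<alpha> - 1)) * (\<Sum>x | x \<in> X \<and> [e x = j] (mod ?P'). w powi e x)"
    by (simp add: pa mult_ac)
  then show ?thesis using p0 by simp
qed

text \<open>The right-hand side of \<open>coset_sums_eq\<close> depends on \<open>j\<close> only
  modulo \<open>p ^ (\<alpha> - 1)\<close>. Hence one empty class makes the partial sums of its
  whole coset vanish.\<close>

lemma coset_sums_cong: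
  fixes z :: complex
  assumes p: "prime p" and "\<alpha> > 0" "N > 0" "coprime p N"
    and "\<And>d. z powi d = 1 \<longleftrightarrow> int (p ^ \<alpha> * N) dvd d"
    and "finite X" "(\<Sum>x\<in>X. z powi e x) = 0"
    and "int N * a + int (p ^ \<alpha>) * b = 1"
    and "w = z powi (int (p ^ \<alpha>) * b)"
    and j: "[i = j] (mod int (p ^ (\<alpha> - 1)))"
  shows "(\<Sum>x | x \<in> X \<and> [e x = i] (mod int (p ^ \<alpha>)). w powi e x) =
    (\<Sum>x | x \<in> X \<and> [e x = j] (mod int (p ^ \<alpha>)). w powi e x)"
proof -
  have "{x. x \<in> X \<and> [e x = i] (mod int (p ^ (\<alpha> - 1)))} =
      {x. x \<in> X \<and> [e x = j] (mod int (p ^ (\<alpha> - 1)))}"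
    using j by (metis cong_trans cong_sym)
  with coset_sums_eq[OF assms(1-9), of i] coset_sums_eq[OF assms(1-9), of j]
  have "of_nat p * (\<Sum>x | x \<in> X \<and> [e x = i] (mod int (p ^ \<alpha>)). w powi e x) =
      of_nat p * (\<Sum>x | x \<in> X \<and> [e x = j] (mod int (p ^ \<alpha>)). w powi e x)"
    by simp
  then show ?thesis using prime_gt_0_nat[OF p] by simp
qed

text \<open>The Bezout identity makes \<open>b\<close> a unit modulo \<open>N\<close>, so the
  component \<open>w\<close> has exact order \<open>N\<close>.\<close>

lemma primitive_component:
  fixes z :: complex
  assumes z: "\<And>d. z powi d = 1 \<longleftrightarrow> int (P * N) dvd d" and P: "P > 0"
    and bez: "int N * a + int P * b = 1" and w: "w = z powi (int P * b)"
  shows "w powi d = 1 \<longleftrightarrow> int N dvd d"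
proof -
  have cop: "coprime (int N) b"
  proof (rule coprimeI)
    fix c assume "c dvd int N" "c dvd b"
    then have "c dvd int N * a + int P * b" by simp
    then show "is_unit c" by (simp only: bez)
  qed
  have "w powi d = 1 \<longleftrightarrow> int (P * N) dvd int P * b * d"
    by (simp only: w power_int_mult [symmetric] z)
  also have "\<dots> \<longleftrightarrow> int P * int N dvd int P * (b * d)" by (simp add: mult_ac)
  also have "\<dots> \<longleftrightarrow> int N dvd b * d" using P by simp
  also have "\<dots> \<longleftrightarrow> int N dvd d"
    using cop by (simp add: coprime_dvd_mult_right_iff)
  finally show ?thesis .
qed

section \<open>Residue classes of exponents and parity of short vanishing sums\<close>

lemma sum_residue_classes:
  fixes g :: "'a \<Rightarrow> 'b :: comm_monoid_add"
  assumes "finite X" "M > 0"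
  shows "(\<Sum>i<M. \<Sum>x | x \<in> X \<and> [e x = int i] (mod int M). g x) = sum g X"
proof -
  have "[e x = int i] (mod int M) \<longleftrightarrow> nat (e x mod int M) = i" if "i < M" for x i
    using that assms(2) by (auto simp: cong_def nat_eq_iff)
  then have "(\<Sum>i<M. \<Sum>x | x \<in> X \<and> [e x = int i] (mod int M). g x) =
      (\<Sum>i<M. \<Sum>x | x \<in> X \<and> nat (e x mod int M) = i. g x)"
    by (intro sum.cong) auto
  also have "\<dots> = sum g X"
    using assms by (intro sum.group) (auto simp: nat_less_iff)
  finally show ?thesis .
qed

lemma card_residue_classes:
  assumes "finite X" "M > 0"
  shows "(\<Sum>i<M. card {x \<in> X. [e x = int i] (mod int M)}) = card X"
  using sum_residue_classes[OF assms, where e = e and g = "\<lambda>_. 1 :: nat"] by simp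

lemma card_cong_class:
  fixes p R i :: nat
  assumes "R > 0"
  shows "card {j. j < p * R \<and> [j = i] (mod R)} = p"
proof -
  have "{j. j < p * R \<and> [j = i] (mod R)} = (\<lambda>t. t * R + i mod R) ` {..<p}"
  proof (intro equalityI subsetI)
    fix j assume j: "j \<in> {j. j < p * R \<and> [j = i] (mod R)}"
    then have "j = j div R * R + i mod R"
      by (metis (mono_tags, lifting) cong_def div_mult_mod_eq mem_Collect_eq)
    moreover have "j div R < p" using j assms by (simp add: less_mult_imp_div_less)
    ultimately show "j \<in> (\<lambda>t. t * R + i mod R) ` {..<p}" by blast
  next
    fix j assume "j \<in> (\<lambda>t. t * R + i mod R) ` {..<p}"
    then obtain t where t: "t < p" "j = t * R + i mod R" by auto
    have "t * R + i mod R < t * R + R" using assms by simp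
    also have "\<dots> = Suc t * R" by simp
    also have "\<dots> \<le> p * R" using t by (intro mult_right_mono) auto
    finally show "j \<in> {j. j < p * R \<and> [j = i] (mod R)}"
      using t by (simp add: cong_def)
  qed
  moreover have "inj_on (\<lambda>t. t * R + i mod R) {..<p}"
    using assms by (auto simp: inj_on_def)
  ultimately show ?thesis by (simp add: card_image)
qed

lemma split_prime_power:
  fixes N :: nat
  assumes "prime q" "q dvd N" "N > 0"
  obtains \<alpha> L where "\<alpha> > 0" "N = q ^ \<alpha> * L" "coprime q L"
proof -
  obtain L where L: "N = q ^ multiplicity q N * L" "\<not> q dvd L"
    using assms by (metis mult.commute multiplicity_decompose' not_gr_zero not_prime_unit)
  moreover have "multiplicity q N > 0" using assms by (simp add: prime_multiplicity_gt_zero_iff)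
  moreover have "coprime q L" using assms(1) L(2) by (simp add: prime_imp_coprime)
  ultimately show thesis using that by blast
qed

lemma bezout_prime_power:
  assumes "coprime p (N::nat)"
  obtains a b where "int N * a + int (p ^ \<alpha>) * b = 1"
proof -
  have "coprime (int N) (int (p ^ \<alpha>))" using assms by (simp add: coprime_commute)
  then obtain a b where "a * int N + b * int (p ^ \<alpha>) = 1"
    using bezout_int[of "int N" "int (p ^ \<alpha>)"] by auto
  then show thesis by (intro that[of a b]) (simp add: mult.commute)
qed

text \<open>With fewer terms than the least odd prime, every coset has an empty class. So each class
  sum vanishes separately and involves one odd prime less. At \<open>M = 1\<close> only signs are
  left, and these cancel in pairs.\<close>

lemma even_card_vanishing:
  fixes z :: complex
  assumes "odd M"
    and "\<And>d. z powi d = 1 \<longleftrightarrow> int (2 * M) dvd d"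
    and "\<And>q. prime q \<Longrightarrow> q dvd M \<Longrightarrow> P \<le> q"
    and "finite X" "card X < P" "(\<Sum>x\<in>X. z powi e x) = 0"
  shows "even (card X)"
  using assms
proof (induction M arbitrary: z X rule: less_induct)
  case (less M)
  have M0: "M > 0" using less.prems by (auto intro: odd_pos)
  show ?case
  proof (cases "M = 1")
    case True
    have "z powi 2 = 1" using less.prems(2)[of 2] True by simp
    moreover have "z \<noteq> 1" using less.prems(2)[of 1] True by auto
    ultimately have z: "z = -1" by (simp add: power2_eq_1_iff)
    define g where "g x = (if even (e x) then 1 else -1 :: int)" for x
    have "of_int (\<Sum>x\<in>X. g x) = (\<Sum>x\<in>X. z powi e x)"
      unfolding of_int_sum by (intro sum.cong) (auto simp: g_def z power_int_minus_left)
    then have "(\<Sum>x\<in>X. g x) = 0" using less.prems by (simp only: of_int_eq_0_iff)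
    then have "int (card X) = (\<Sum>x\<in>X. g x + 1)" by (simp add: sum.distrib)
    moreover have "even (\<Sum>x\<in>X. g x + 1)" by (intro dvd_sum) (auto simp: g_def)
    ultimately show ?thesis by (metis even_of_nat)
  next
    case False
    then obtain q where q: "prime q" "q dvd M" using prime_factor_nat by blast
    obtain \<alpha> L where L: "\<alpha> > 0" "M = q ^ \<alpha> * L" "coprime q L"
      using split_prime_power[OF q M0] .
    have "odd q" using q less.prems(1) by (auto dest: dvd_trans)
    then have cop: "coprime q (2 * L)" using L by simp
    obtain a b where bez: "int (2 * L) * a + int (q ^ \<alpha>) * b = 1"
      using bezout_prime_power[OF cop] .
    define w where "w = z powi (int (q ^ \<alpha>) * b)"
    have q0: "q > 0" using q prime_gt_0_nat by blast
    have L0: "L > 0" using L M0 by (cases "L = 0") auto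
    have qa: "q ^ \<alpha> = q * q ^ (\<alpha> - 1)" using L(1) by (simp flip: power_Suc)
    have zd: "z powi d = 1 \<longleftrightarrow> int (q ^ \<alpha> * (2 * L)) dvd d" for d
      using less.prems(2) by (simp add: L(2) mult_ac)
    have wd: "w powi d = 1 \<longleftrightarrow> int (2 * L) dvd d" for d
      by (rule primitive_component[OF zd _ bez w_def]) (use q0 in simp)
    have "L < M" using L one_less_power[OF prime_gt_1_nat[OF q(1)] L(1)] L0 by simp
    have "odd L" using less.prems(1) L(2) by simp
    let ?X = "\<lambda>i. {x \<in> X. [e x = int i] (mod int (q ^ \<alpha>))}"
    have even: "even (card (?X i))" for i
    proof -
      let ?K = "{j. j < q * q ^ (\<alpha> - 1) \<and> [j = i] (mod q ^ (\<alpha> - 1))}"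
      have "card ?K = q" using card_cong_class[of "q ^ (\<alpha> - 1)" q i] q0 by simp
      have finK: "finite ?K" by simp
      \<comment> \<open>Pigeonhole: the coset consists of \<open>q\<close> classes, and
        \<open>X\<close> has fewer than \<open>P \<le> q\<close> elements.\<close>
      have "\<exists>j\<in>?K. ?X j = {}"
      proof (rule ccontr)
        assume "\<not> ?thesis"
        then have "(\<Sum>j\<in>?K. 1) \<le> (\<Sum>j\<in>?K. card (?X j))"
          using less.prems(4) by (intro sum_mono) (auto simp: Suc_le_eq card_gt_0_iff)
        also have "\<dots> \<le> (\<Sum>j<q ^ \<alpha>. card (?X j))"
          by (rule sum_mono2) (auto simp: qa)
        also have "\<dots> = card X" using card_residue_classes[OF less.prems(4), of "q ^ \<alpha>" e] q0 by simp
        finally have "q \<le> card X" using \<open>card ?K = q\<close> by simp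
        then show False using less.prems(3)[OF q] less.prems(5) by simp
      qed
      then obtain j where j: "[j = i] (mod q ^ (\<alpha> - 1))" "?X j = {}" by auto
      have "[int i = int j] (mod int (q ^ (\<alpha> - 1)))"
        using j(1) by (simp only: cong_int_iff cong_sym_eq)
      then have "(\<Sum>x\<in>?X i. w powi e x) = (\<Sum>x\<in>?X j. w powi e x)"
        using coset_sums_cong[OF q(1) L(1) _ cop zd less.prems(4,6) bez w_def] L0 by simp
      then have "(\<Sum>x\<in>?X i. w powi e x) = 0" by (simp only: j(2) sum.empty)
      moreover have "P \<le> q'" if "prime q'" "q' dvd L" for q'
        using less.prems(3)[OF that(1)] that(2) L(2) by simp
      moreover have "finite (?X i)" using less.prems(4) by simp
      moreover have "card (?X i) < P"
        using card_mono[of X "?X i"] less.prems(4,5) by (simp add: le_less_trans)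
      ultimately show ?thesis using less.IH[OF \<open>L < M\<close> \<open>odd L\<close> wd] by blast
    qed
    have "even (\<Sum>i<q ^ \<alpha>. card (?X i))" by (intro dvd_sum even)
    then show ?thesis using card_residue_classes[OF less.prems(4), of "q ^ \<alpha>" e] q0 by simp
  qed
qed

text \<open>
  The classes modulo \<open>p\<^sup>\<alpha>\<close> on which the partial sum does not vanish come in full cosets of
  size \<open>p\<close>. The length bound leaves room for one such coset, whose classes all have odd size,
  while the remaining classes have even size.
\<close>
lemma projection_vanishing:
  fixes z :: complex
  assumes p: "prime p" "odd p" and a: "\<alpha> > 0" and M: "odd M" and copM: "coprime p M"
    and z: "\<And>d. z powi d = 1 \<longleftrightarrow> int (p ^ \<alpha> * (2 * M)) dvd d"
    and P: "P \<le> p" "\<And>q. prime q \<Longrightarrow> q dvd M \<Longrightarrow> P \<le> q"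
    and fin: "finite X" and ev: "even (card X)" and len: "card X + 2 < p + P"
    and vanish: "(\<Sum>x\<in>X. z powi e x) = 0"
    and bez: "int (2 * M) * a + int (p ^ \<alpha>) * b = 1"
    and w: "w = z powi (int (p ^ \<alpha>) * b)"
  shows "(\<Sum>x\<in>X. w powi e x) = 0"
proof (rule ccontr)
  assume nz: "(\<Sum>x\<in>X. w powi e x) \<noteq> 0"
  define R where "R = p ^ (\<alpha> - 1)"
  define Y where "Y i = {x \<in> X. [e x = int i] (mod int (p ^ \<alpha>))}" for i :: nat
  define n where "n i = card (Y i)" for i
  define c where "c i = (\<Sum>x\<in>Y i. w powi e x)" for i
  define K where "K i = {j. j < p ^ \<alpha> \<and> [j = i] (mod R)}" for i
  have M0: "M > 0" using M by (auto intro: odd_pos)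
  have p0: "p > 0" using p prime_gt_0_nat by blast
  have R0: "R > 0" using p0 by (simp add: R_def)
  have pR: "p ^ \<alpha> = p * R" using a by (simp add: R_def flip: power_Suc)
  have cop: "coprime p (2 * M)" using copM p by simp
  have wd: "w powi d = 1 \<longleftrightarrow> int (2 * M) dvd d" for d
    by (rule primitive_component[OF z _ bez w]) (use p0 in simp)
  have w0: "w \<noteq> 0" using wd[of "int (2 * M)"] M0 by auto
  have cardK: "card (K i) = p" and finK: "finite (K i)" for i
    using card_cong_class[OF R0, of p i] by (simp_all add: K_def pR)
  have finY: "finite (Y i)" for i using fin by (simp add: Y_def)
  have c_cong: "c i = c j" if "j \<in> K i" for i j
  proof -
    have "[int i = int j] (mod int (p ^ (\<alpha> - 1)))"
      using that by (simp only: cong_int_iff cong_sym_eq K_def R_def mem_Collect_eq)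
    then show ?thesis
      using coset_sums_cong[OF p(1) a _ cop z fin vanish bez w] M0 by (simp add: c_def Y_def)
  qed
  have sum_n: "(\<Sum>i<p ^ \<alpha>. n i) = card X"
    using card_residue_classes[OF fin, of "p ^ \<alpha>" e] p0 by (simp add: n_def Y_def)
  have "(\<Sum>i<p ^ \<alpha>. c i) = (\<Sum>x\<in>X. w powi e x)"
    using sum_residue_classes[OF fin, where M = "p ^ \<alpha>" and e = e and g = "\<lambda>x. w powi e x"] p0 by (simp add: c_def Y_def)
  with nz obtain i0 where i0: "i0 < p ^ \<alpha>" "c i0 \<noteq> 0"
    by (metis (no_types, lifting) lessThan_iff sum.neutral)
  have n_eq_0: "c i = 0" if "n i = 0" for i
    using that finY by (simp add: n_def c_def)
  have n_pos: "n j \<ge> 1" if "j \<in> K i0" for j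
    using c_cong[OF that] i0(2) n_eq_0[of j] by (cases "n j = 0") auto
  have K_sub: "K i \<subseteq> {..<p ^ \<alpha>}" for i by (auto simp: K_def)
  have sumK_le: "(\<Sum>j\<in>K i0. n j) \<le> card X"
    unfolding sum_n [symmetric] by (rule sum_mono2) (use K_sub in auto)
  have "\<exists>j\<in>K i0. n j = 1"
  proof (rule ccontr)
    assume "\<not> ?thesis"
    then have "(\<Sum>j\<in>K i0. 2) \<le> (\<Sum>j\<in>K i0. n j)"
      using n_pos by (intro sum_mono) (metis One_nat_def Suc_1 le_neq_implies_less Suc_leI)
    then show False using sumK_le len P(1) cardK[of i0] by simp
  qed
  then obtain j0 where j0: "j0 \<in> K i0" "n j0 = 1" by blast
  then obtain x0 where x0: "Y j0 = {x0}" by (auto simp: n_def card_1_singleton_iff)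
  have c0: "c i0 = w powi e x0" using c_cong[OF j0(1)] x0 by (simp add: c_def)
  have wM: "w powi int M = -1"
  proof -
    have "(w powi int M)\<^sup>2 = w powi int (2 * M)"
      by (simp only: power_int_power' of_nat_mult mult.commute of_nat_numeral)
    also have "\<dots> = 1" by (simp only: wd dvd_refl)
    finally have "w powi int M = 1 \<or> w powi int M = -1" by (simp add: power2_eq_1_iff)
    moreover have "\<not> int (2 * M) dvd int M"
      using M0 by (simp only: int_dvd_int_iff) (auto dest: dvd_imp_le)
    ultimately show ?thesis using wd by blast
  qed
  have odd_n: "odd (n j)" if j: "j \<in> K i0" for j
  proof (cases "j = j0")
    case True
    then show ?thesis using j0 by simp
  next
    case False
    have x0j: "x0 \<notin> Y j"
    proof
      assume "x0 \<in> Y j"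
      moreover have "x0 \<in> Y j0" using x0 by simp
      ultimately have "[int j = int j0] (mod int (p ^ \<alpha>))"
        unfolding Y_def by (metis (mono_tags, lifting) cong_sym cong_trans mem_Collect_eq)
      then have "j = j0" using j j0(1) by (auto simp: K_def cong_int_iff cong_def simp del: of_nat_power)
      with False show False by simp
    qed
    have "p - 1 = (\<Sum>i\<in>K i0 - {j}. 1)" using j cardK[of i0] finK[of i0] by simp
    also have "\<dots> \<le> (\<Sum>i\<in>K i0 - {j}. n i)" using n_pos by (intro sum_mono) auto
    finally have "n j + (p - 1) \<le> (\<Sum>i\<in>K i0. n i)"
      using j finK[of i0] by (simp add: sum.remove)
    with sumK_le len p0 have nj: "n j + 1 < P" by linarith
    \<comment> \<open>A class sum of this coset equals the single term at \<open>x0\<close>.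
      Appending the negative of that term, with -1 written as \<open>w powi int M\<close>, gives a
      short vanishing sum. As \<open>x0\<close> lies outside \<open>Y j\<close>, it can label the
      extra term.\<close>
    define e' where "e' x = (if x = x0 then e x0 + int M else e x)" for x
    have "(\<Sum>x\<in>insert x0 (Y j). w powi e' x) = w powi (e x0 + int M) + (\<Sum>x\<in>Y j. w powi e' x)"
      using x0j finY by (simp add: e'_def)
    also have "(\<Sum>x\<in>Y j. w powi e' x) = c j"
      unfolding c_def using x0j by (intro sum.cong) (auto simp: e'_def)
    also have "w powi (e x0 + int M) = - c j"
      using w0 wM c0 c_cong[OF j] by (simp add: power_int_add)
    finally have "(\<Sum>x\<in>insert x0 (Y j). w powi e' x) = 0" by simp
    moreover have "card (insert x0 (Y j)) = n j + 1" using x0j finY by (simp add: n_def)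
    moreover have "finite (insert x0 (Y j))" using finY by simp
    ultimately have "even (n j + 1)"
      using even_card_vanishing[OF M wd P(2), of "insert x0 (Y j)" e'] nj by simp
    then show ?thesis by simp
  qed
  have even_n: "even (n j)" if j: "j < p ^ \<alpha>" "j \<notin> K i0" for j
  proof -
    have jK: "j \<in> K j" using j by (simp add: K_def)
    have disj: "K i0 \<inter> K j = {}"
      using j by (auto simp: K_def) (metis cong_sym cong_trans)
    \<comment> \<open>The coset of \<open>i0\<close> uses up at least \<open>p\<close> terms, so any
      other coset has fewer than \<open>P \<le> p\<close> and hence an empty class.\<close>
    have "p = (\<Sum>i\<in>K i0. 1)" using cardK by simp
    also have "\<dots> \<le> (\<Sum>i\<in>K i0. n i)" using n_pos by (intro sum_mono) auto
    finally have "p + (\<Sum>i\<in>K j. n i) \<le> (\<Sum>i\<in>K i0 \<union> K j. n i)"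
      using disj finK by (simp add: sum.union_disjoint)
    also have "\<dots> \<le> card X"
      unfolding sum_n [symmetric] by (rule sum_mono2) (use K_sub in auto)
    finally have s: "(\<Sum>i\<in>K j. n i) + 2 < P" using len by simp
    have "\<exists>i\<in>K j. n i = 0"
    proof (rule ccontr)
      assume "\<not> ?thesis"
      then have "(\<Sum>i\<in>K j. 1) \<le> (\<Sum>i\<in>K j. n i)" by (intro sum_mono) (auto simp: Suc_le_eq)
      then show False using s P(1) cardK[of j] by simp
    qed
    then have "c j = 0" using c_cong n_eq_0 by metis
    moreover have "n j \<le> (\<Sum>i\<in>K j. n i)" using jK finK by (intro member_le_sum) auto
    then have "card (Y j) < P" using s by (simp add: n_def)
    ultimately show ?thesis
      using even_card_vanishing[OF M wd P(2) finY, of j e] by (simp add: n_def c_def)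
  qed
  have "(\<Sum>i<p ^ \<alpha>. n i) = (\<Sum>i\<in>{..<p ^ \<alpha>} - K i0. n i) + (\<Sum>i\<in>K i0. n i)"
    using K_sub by (intro sum.subset_diff) auto
  moreover have "even (\<Sum>i\<in>{..<p ^ \<alpha>} - K i0. n i)"
    by (intro dvd_sum) (use even_n in auto)
  moreover have "even (\<Sum>i\<in>K i0. n i + 1)" by (intro dvd_sum) (use odd_n in auto)
  then have "odd (\<Sum>i\<in>K i0. n i)" using cardK[of i0] p(2) by (simp only: sum.distrib) simp
  ultimately show False using ev sum_n by simp
qed

section \<open>Walsh transforms and autocorrelations\<close>

definition vadd :: "nat \<Rightarrow> (nat \<Rightarrow> int) \<Rightarrow> (nat \<Rightarrow> int) \<Rightarrow> nat \<Rightarrow> int" where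
  "vadd n x a = (\<lambda>i\<in>{..<n}. (x i + a i) mod 2)"

definition vzero :: "nat \<Rightarrow> nat \<Rightarrow> int" where
  "vzero n = (\<lambda>i\<in>{..<n}. 0)"

text \<open>Integer values keep the character available for the parity and divisibility arguments on
  integer Walsh transforms.\<close>

definition chi :: "nat \<Rightarrow> (nat \<Rightarrow> int) \<Rightarrow> (nat \<Rightarrow> int) \<Rightarrow> int" where
  "chi n y x = (if Z2_inner n y x = 0 then 1 else -1)"

lemma carrier_residue_ring: "carrier (residue_ring m) = {0..m - 1}"
  by (simp add: residue_ring_def)

lemma finite_Z2_vec [simp]: "finite (Z2_vec n)"
  by (auto simp: Z2_vec_def carrier_residue_ring intro: finite_PiE)

lemma card_Z2_vec [simp]: "card (Z2_vec n) = 2 ^ n"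
  by (simp add: Z2_vec_def card_PiE carrier_residue_ring)

lemma Z2_vec_nth:
  assumes "x \<in> Z2_vec n" "i < n"
  shows "x i = 0 \<or> x i = 1"
proof -
  have "x i \<in> {0..2 - 1}"
    using assms unfolding Z2_vec_def carrier_residue_ring by (intro PiE_mem[of x]) auto
  then show ?thesis by auto
qed

lemma Z2_vec_eqI:
  assumes "x \<in> Z2_vec n" "y \<in> Z2_vec n" "\<And>i. i < n \<Longrightarrow> x i = y i"
  shows "x = y"
  using assms unfolding Z2_vec_def by (intro PiE_ext[of x _ _ y]) auto

lemma vadd_closed [simp]: "vadd n x a \<in> Z2_vec n"
  using pos_mod_bound[of 2] by (auto simp: Z2_vec_def carrier_residue_ring vadd_def zle_diff1_eq)

lemma vzero_closed [simp]: "vzero n \<in> Z2_vec n"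
  by (auto simp: Z2_vec_def carrier_residue_ring vzero_def)

lemma vadd_commute: "vadd n x a = vadd n a x"
  by (auto simp: vadd_def add.commute)

lemma vadd_cancel [simp]:
  assumes "x \<in> Z2_vec n"
  shows "vadd n (vadd n x a) a = x"
proof (rule Z2_vec_eqI[OF _ assms])
  fix i assume i: "i < n"
  have "((x i + a i) mod 2 + a i) mod 2 = (x i + a i + a i) mod 2"
    by (rule mod_add_left_eq)
  also have "x i + a i + a i = x i + 2 * a i" by simp
  finally show "vadd n (vadd n x a) a i = x i"
    using i Z2_vec_nth[OF assms i] by (auto simp: vadd_def)
qed simp

lemma vadd_vzero [simp]:
  assumes "x \<in> Z2_vec n"
  shows "vadd n x (vzero n) = x" "vadd n (vzero n) x = x"
proof -
  show "vadd n x (vzero n) = x"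
  proof (rule Z2_vec_eqI[OF _ assms])
    fix i assume i: "i < n"
    then show "vadd n x (vzero n) i = x i"
      using Z2_vec_nth[OF assms i] by (auto simp: vadd_def vzero_def)
  qed simp
  then show "vadd n (vzero n) x = x" by (simp add: vadd_commute)
qed

lemma vadd_eq_vzero_iff:
  assumes "x \<in> Z2_vec n" "a \<in> Z2_vec n"
  shows "vadd n x a = vzero n \<longleftrightarrow> x = a"
proof
  assume "vadd n x a = vzero n"
  then have "vadd n (vadd n x a) a = a" using assms by simp
  then show "x = a" using assms by simp
next
  have "vadd n (vadd n (vzero n) a) a = vzero n" by (rule vadd_cancel) simp
  then have "vadd n a a = vzero n" using assms by simp
  then show "x = a \<Longrightarrow> vadd n x a = vzero n" by simp
qed

lemma sum_translate:
  assumes "a \<in> Z2_vec n"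
  shows "(\<Sum>x\<in>Z2_vec n. h (vadd n x a)) = (\<Sum>x\<in>Z2_vec n. h x)"
  by (rule sum.reindex_bij_witness[where i = "\<lambda>x. vadd n x a" and j = "\<lambda>x. vadd n x a"]) auto

lemma chi_eq: "chi n y x = (if even (\<Sum>i<n. y i * x i) then 1 else -1)"
  by (simp add: chi_def Z2_inner_def even_iff_mod_2_eq_zero)

lemma chi_cases: "chi n y x = 1 \<or> chi n y x = -1"
  by (simp add: chi_def)

lemma chi_commute: "chi n y x = chi n x y"
  by (simp add: chi_eq mult.commute)

lemma chi_square [simp]: "chi n y x * chi n y x = 1"
  using chi_cases[of n y x] by auto

lemma chi_vzero [simp]: "chi n y (vzero n) = 1"
  by (simp add: chi_eq vzero_def)

lemma powi_Z2_inner: "(-1) powi Z2_inner n y x = of_int (chi n y x)"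
  by (auto simp: chi_def Z2_inner_def power_int_minus_left even_iff_mod_2_eq_zero)

lemma chi_vadd: "chi n y (vadd n x a) = chi n y x * chi n y a"
proof -
  have "even (\<Sum>i<n. y i * vadd n x a i) \<longleftrightarrow> even (\<Sum>i<n. y i * (x i + a i))"
  proof -
    have "even (\<Sum>i<n. y i * (x i + a i) - y i * vadd n x a i)"
      by (intro dvd_sum) (auto simp: vadd_def minus_mod_eq_mult_div simp flip: right_diff_distrib)
    then show ?thesis by (simp only: sum_subtractf even_diff) auto
  qed
  then show ?thesis by (auto simp: chi_eq distrib_left sum.distrib)
qed

text \<open>If \<open>a\<close> is nonzero at coordinate \<open>i\<close>, translating
  \<open>y\<close> by the \<open>i\<close>-th unit vector flips the sign of every term.\<close>

lemma sum_chi: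
  assumes "a \<in> Z2_vec n"
  shows "(\<Sum>y\<in>Z2_vec n. chi n y a) = (if a = vzero n then 2 ^ n else 0)"
proof (cases "a = vzero n")
  case False
  then obtain i where i: "i < n" "a i \<noteq> 0"
    using Z2_vec_eqI[OF assms vzero_closed] by (auto simp: vzero_def)
  then have ai: "a i = 1" using Z2_vec_nth[OF assms] by blast
  define e where "e = (\<lambda>j\<in>{..<n}. if j = i then 1 else 0 :: int)"
  have e: "e \<in> Z2_vec n" by (auto simp: e_def Z2_vec_def carrier_residue_ring)
  have "(\<Sum>j<n. e j * a j) = (\<Sum>j<n. if j = i then a i else 0)"
    by (intro sum.cong) (auto simp: e_def)
  then have "chi n e a = -1" using i ai by (simp add: chi_eq)
  then have "chi n (vadd n y e) a = - chi n y a" for y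
    by (simp add: chi_commute[of n _ a] chi_vadd)
  then have "(\<Sum>y\<in>Z2_vec n. chi n y a) = - (\<Sum>y\<in>Z2_vec n. chi n y a)"
    using sum_translate[OF e, of "\<lambda>y. chi n y a"] by (simp add: sum_negf)
  with False show ?thesis by simp
qed simp

section \<open>Wiener-Khinchin and Fourier inversion over Z_2^n\<close>

definition walsh :: "nat \<Rightarrow> ((nat \<Rightarrow> int) \<Rightarrow> complex) \<Rightarrow> (nat \<Rightarrow> int) \<Rightarrow> complex" where
  "walsh n u y = (\<Sum>x\<in>Z2_vec n. u x * of_int (chi n y x))"

definition autocorr :: "nat \<Rightarrow> ((nat \<Rightarrow> int) \<Rightarrow> complex) \<Rightarrow> (nat \<Rightarrow> int) \<Rightarrow> complex" where
  "autocorr n u a = (\<Sum>x\<in>Z2_vec n. u (vadd n x a) * cnj (u x))"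

lemma gbf_transform_eq_walsh: "gbf_transform m n f = walsh n (\<lambda>x. zeta m powi f x)"
  by (simp add: fun_eq_iff gbf_transform_def walsh_def powi_Z2_inner)

text \<open>The double sum for the squared modulus is regrouped by the difference \<open>a\<close>
  of its two arguments.\<close>

lemma walsh_autocorr:
  "walsh n u y * cnj (walsh n u y) = (\<Sum>a\<in>Z2_vec n. of_int (chi n y a) * autocorr n u a)"
proof -
  have "walsh n u y * cnj (walsh n u y) =
      (\<Sum>x\<in>Z2_vec n. \<Sum>x'\<in>Z2_vec n. u x' * of_int (chi n y x') * (cnj (u x) * of_int (chi n y x)))"
    by (simp add: walsh_def sum_product cnj_sum) (rule sum.swap)
  also have "\<dots> = (\<Sum>x\<in>Z2_vec n. \<Sum>a\<in>Z2_vec n.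
      u (vadd n x a) * of_int (chi n y (vadd n x a)) * (cnj (u x) * of_int (chi n y x)))"
  proof (rule sum.cong[OF refl])
    fix x assume x: "x \<in> Z2_vec n"
    let ?h = "\<lambda>x'. u x' * of_int (chi n y x') * (cnj (u x) * of_int (chi n y x))"
    have "sum ?h (Z2_vec n) = (\<Sum>a\<in>Z2_vec n. ?h (vadd n a x))"
      using sum_translate[OF x, of ?h] by simp
    also have "\<dots> = (\<Sum>a\<in>Z2_vec n. ?h (vadd n x a))"
      by (intro sum.cong refl arg_cong[where f = ?h] vadd_commute)
    finally show "sum ?h (Z2_vec n) = (\<Sum>a\<in>Z2_vec n. ?h (vadd n x a))" .
  qed
  also have "\<dots> = (\<Sum>x\<in>Z2_vec n. \<Sum>a\<in>Z2_vec n. of_int (chi n y a) * (u (vadd n x a) * cnj (u x)))"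
  proof (intro sum.cong refl)
    fix x a
    have "of_int (chi n y (vadd n x a)) * of_int (chi n y x) = (of_int (chi n y a) :: complex)"
      unfolding of_int_mult [symmetric] chi_vadd by (simp add: algebra_simps flip: mult.assoc)
    then show "u (vadd n x a) * of_int (chi n y (vadd n x a)) * (cnj (u x) * of_int (chi n y x)) =
      of_int (chi n y a) * (u (vadd n x a) * cnj (u x))"
      by (metis (no_types, opaque_lifting) mult.assoc mult.commute)
  qed
  also have "\<dots> = (\<Sum>a\<in>Z2_vec n. of_int (chi n y a) * autocorr n u a)"
    by (subst sum.swap) (simp add: autocorr_def sum_distrib_left)
  finally show ?thesis .
qed

text \<open>Inversion of \<open>walsh_autocorr\<close> by orthogonality of characters.\<close>

lemma sum_chi_walsh:
  assumes "b \<in> Z2_vec n"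
  shows "(\<Sum>y\<in>Z2_vec n. of_int (chi n y b) * (walsh n u y * cnj (walsh n u y))) =
    2 ^ n * autocorr n u b"
proof -
  have chi: "(\<Sum>y\<in>Z2_vec n. chi n y b * chi n y a) = (if a = b then 2 ^ n else 0)"
    if "a \<in> Z2_vec n" for a
    using sum_chi[of "vadd n b a" n] that assms
    by (simp only: chi_vadd vadd_closed vadd_eq_vzero_iff simp_thms) auto
  have "(\<Sum>y\<in>Z2_vec n. of_int (chi n y b) * (walsh n u y * cnj (walsh n u y))) =
     (\<Sum>y\<in>Z2_vec n. \<Sum>a\<in>Z2_vec n. of_int (chi n y b * chi n y a) * autocorr n u a)"
    unfolding walsh_autocorr sum_distrib_left of_int_mult by (simp only: mult.assoc)
  also have "\<dots> = (\<Sum>a\<in>Z2_vec n. of_int (\<Sum>y\<in>Z2_vec n. chi n y b * chi n y a) * autocorr n u a)"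
    unfolding of_int_sum sum_distrib_right by (rule sum.swap)
  also have "\<dots> = (\<Sum>a\<in>Z2_vec n. if a = b then 2 ^ n * autocorr n u a else 0)"
    by (rule sum.cong[OF refl]) (simp only: chi, simp)
  finally show ?thesis using assms by simp
qed

lemma autocorr_vzero:
  assumes "\<And>x. x \<in> Z2_vec n \<Longrightarrow> cmod (u x) = 1"
  shows "autocorr n u (vzero n) = 2 ^ n"
proof -
  have "autocorr n u (vzero n) = (\<Sum>x\<in>Z2_vec n. 1)"
    unfolding autocorr_def
  proof (rule sum.cong[OF refl])
    fix x assume x: "x \<in> Z2_vec n"
    have "u x * cnj (u x) = of_real ((cmod (u x))\<^sup>2)"
      by (rule complex_norm_square [symmetric])
    then have "u x * cnj (u x) = 1"
      using assms[OF x] by (simp only: power_one of_real_1)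
    then show "u (vadd n x (vzero n)) * cnj (u x) = 1" using x by simp
  qed
  then show ?thesis by simp
qed

text \<open>The squared spectrum is the transform of the autocorrelation, and a function is constant
  exactly when its transform is concentrated at zero.\<close>

lemma flat_spectrum_iff:
  assumes "\<And>x. x \<in> Z2_vec n \<Longrightarrow> cmod (u x) = 1"
  shows "(\<forall>y\<in>Z2_vec n. (cmod (walsh n u y))\<^sup>2 = 2 ^ n) \<longleftrightarrow>
    (\<forall>a\<in>Z2_vec n. a \<noteq> vzero n \<longrightarrow> autocorr n u a = 0)"
proof (intro iffI ballI impI)
  fix a assume *: "\<forall>y\<in>Z2_vec n. (cmod (walsh n u y))\<^sup>2 = 2 ^ n" and a: "a \<in> Z2_vec n" "a \<noteq> vzero n"
  have "walsh n u y * cnj (walsh n u y) = 2 ^ n" if "y \<in> Z2_vec n" for y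
  proof -
    have "walsh n u y * cnj (walsh n u y) = of_real ((cmod (walsh n u y))\<^sup>2)"
      by (rule complex_norm_square [symmetric])
    then show ?thesis
      using *[rule_format, OF that] by (simp only: of_real_power of_real_numeral)
  qed
  then have "2 ^ n * autocorr n u a = (\<Sum>y\<in>Z2_vec n. of_int (chi n y a) * 2 ^ n)"
    unfolding sum_chi_walsh[OF a(1), symmetric] by simp
  also have "\<dots> = of_int (\<Sum>y\<in>Z2_vec n. chi n y a) * 2 ^ n"
    by (simp only: of_int_sum sum_distrib_right)
  also have "\<dots> = 0" using a by (simp only: sum_chi) simp
  finally show "autocorr n u a = 0" by simp
next
  fix y assume *: "\<forall>a\<in>Z2_vec n. a \<noteq> vzero n \<longrightarrow> autocorr n u a = 0" and y: "y \<in> Z2_vec n"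
  have "walsh n u y * cnj (walsh n u y) = (\<Sum>a\<in>Z2_vec n. if a = vzero n then 2 ^ n else 0)"
    unfolding walsh_autocorr using * autocorr_vzero[OF assms] by (intro sum.cong) auto
  also have "\<dots> = of_real (2 ^ n)" by simp
  finally show "(cmod (walsh n u y))\<^sup>2 = 2 ^ n"
    by (simp only: complex_norm_square [symmetric] of_real_eq_iff)
qed

section \<open>The root of unity \<open>zeta m\<close> and bentness as vanishing sums\<close>

lemma zeta_eq_cis: "zeta m = cis (2 * pi / of_nat m)"
  by (simp add: zeta_def cis_conv_exp mult_ac)

lemma zeta_powi_eq_1_iff:
  assumes "m > 0"
  shows "zeta m powi d = 1 \<longleftrightarrow> int m dvd d"
proof -
  have e: "zeta m powi d = cis (of_int d * (2 * pi / of_nat m))"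
    by (simp add: zeta_eq_cis cis_power_int)
  show ?thesis
  proof
    assume "zeta m powi d = 1"
    then have "cos (of_int d * (2 * pi / of_nat m)) = 1"
      by (metis e cis.sel(1) one_complex.sel(1))
    then obtain k :: int where "of_int d * (2 * pi / of_nat m) = of_int k * 2 * pi"
      by (auto simp: cos_one_2pi_int)
    then have "real_of_int d = of_int (k * int m)" using assms by (simp add: field_simps)
    then have "d = k * int m" by (simp only: of_int_eq_iff)
    then show "int m dvd d" by simp
  next
    assume "int m dvd d"
    then obtain k where "d = int m * k" by (auto simp: dvd_def)
    then have "of_int d * (2 * pi / of_nat m) = 2 * pi * of_int k" using assms by simp
    then show "zeta m powi d = 1" by (simp add: e cis_multiple_2pi)
  qed
qed

lemma cmod_zeta [simp]: "cmod (zeta m) = 1"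
  by (simp add: zeta_eq_cis)

lemma cmod_zeta_powi [simp]: "cmod (zeta m powi k) = 1"
  by (simp add: norm_power_int)

lemma cnj_zeta: "cnj (zeta m) = inverse (zeta m)"
  by (simp add: zeta_eq_cis cis_cnj cis_inverse)

lemma zeta_neq_0 [simp]: "zeta m \<noteq> 0"
  by (simp add: zeta_def)

lemma autocorr_zeta:
  "autocorr n (\<lambda>x. zeta m powi f x) a = (\<Sum>x\<in>Z2_vec n. zeta m powi (f (vadd n x a) - f x))"
  by (simp add: autocorr_def cnj_zeta power_int_inverse power_int_diff divide_inverse)

lemma generalized_bent_iff:
  "generalized_bent m n f \<longleftrightarrow> f \<in> Z2_vec n \<rightarrow> {0..int m - 1} \<and>
    (\<forall>a\<in>Z2_vec n. a \<noteq> vzero n \<longrightarrow> (\<Sum>x\<in>Z2_vec n. zeta m powi (f (vadd n x a) - f x)) = 0)"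
  unfolding generalized_bent_def carrier_residue_ring gbf_transform_eq_walsh
  by (subst flat_spectrum_iff) (auto simp: autocorr_zeta)

section \<open>One odd prime: divisibility of the sign autocorrelation\<close>

lemma square_eq_two_power_int:
  fixes k :: int
  assumes "k\<^sup>2 = 2 ^ n"
  shows "even n"
proof -
  have "k \<noteq> 0" using assms by auto
  then have "multiplicity 2 (k\<^sup>2) = 2 * multiplicity 2 k"
    by (subst prime_elem_multiplicity_power_distrib) auto
  moreover have "multiplicity 2 ((2::int) ^ n) = n" by simp
  ultimately show ?thesis using assms by simp
qed

text \<open>At a coordinate where \<open>a\<close> is 1, translation by \<open>a\<close> exchanges
  the two half-spaces, so the sum is twice the sum over one half.\<close>

lemma sum_invariant_dvd:
  fixes h :: "(nat \<Rightarrow> int) \<Rightarrow> int"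
  assumes a: "a \<in> Z2_vec n" "a \<noteq> vzero n"
    and inv: "\<And>x. x \<in> Z2_vec n \<Longrightarrow> h (vadd n x a) = h x"
    and dvd: "\<And>x. x \<in> Z2_vec n \<Longrightarrow> d dvd h x"
  shows "2 * d dvd (\<Sum>x\<in>Z2_vec n. h x)"
proof -
  obtain i where i: "i < n" "a i \<noteq> 0"
    using Z2_vec_eqI[OF a(1) vzero_closed] a(2) by (auto simp: vzero_def)
  then have ai: "a i = 1" using Z2_vec_nth[OF a(1)] by blast
  have nth: "vadd n x a i = (x i + 1) mod 2" for x
    using i(1) ai by (simp add: vadd_def)
  let ?H0 = "{x \<in> Z2_vec n. x i = 0}" and ?H1 = "{x \<in> Z2_vec n. x i = 1}"
  have "Z2_vec n = ?H0 \<union> ?H1" using Z2_vec_nth[OF _ i(1)] by blast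
  then have "(\<Sum>x\<in>Z2_vec n. h x) = (\<Sum>x\<in>?H0 \<union> ?H1. h x)" by (rule arg_cong)
  also have "\<dots> = (\<Sum>x\<in>?H0. h x) + (\<Sum>x\<in>?H1. h x)"
    by (rule sum.union_disjoint) auto
  also have "(\<Sum>x\<in>?H1. h x) = (\<Sum>x\<in>?H0. h x)"
    by (rule sum.reindex_bij_witness[where i = "\<lambda>x. vadd n x a" and j = "\<lambda>x. vadd n x a"])
      (auto simp: nth inv)
  finally have "(\<Sum>x\<in>Z2_vec n. h x) = 2 * (\<Sum>x\<in>?H0. h x)" by simp
  moreover have "d dvd (\<Sum>x\<in>?H0. h x)" by (intro dvd_sum dvd) simp
  ultimately show ?thesis by simp
qed

definition int_walsh :: "nat \<Rightarrow> ((nat \<Rightarrow> int) \<Rightarrow> int) \<Rightarrow> (nat \<Rightarrow> int) \<Rightarrow> int" where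
  "int_walsh n g y = (\<Sum>x\<in>Z2_vec n. g x * chi n y x)"

definition int_autocorr :: "nat \<Rightarrow> ((nat \<Rightarrow> int) \<Rightarrow> int) \<Rightarrow> (nat \<Rightarrow> int) \<Rightarrow> int" where
  "int_autocorr n g a = (\<Sum>x\<in>Z2_vec n. g (vadd n x a) * g x)"

lemma walsh_of_int: "walsh n (\<lambda>x. of_int (g x)) y = of_int (int_walsh n g y)"
  by (simp add: walsh_def int_walsh_def)

lemma autocorr_of_int: "autocorr n (\<lambda>x. of_int (g x)) a = of_int (int_autocorr n g a)"
  by (simp add: autocorr_def int_autocorr_def)

lemma int_walsh_square: "(int_walsh n g y)\<^sup>2 = (\<Sum>a\<in>Z2_vec n. chi n y a * int_autocorr n g a)"
proof -
  have "(of_int ((int_walsh n g y)\<^sup>2) :: complex) = of_int (\<Sum>a\<in>Z2_vec n. chi n y a * int_autocorr n g a)"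
    using walsh_autocorr[of n "\<lambda>x. of_int (g x)" y]
    by (simp add: walsh_of_int autocorr_of_int power2_eq_square)
  then show ?thesis by (simp only: of_int_eq_iff)
qed

lemma int_parseval: "(\<Sum>y\<in>Z2_vec n. (int_walsh n g y)\<^sup>2) = 2 ^ n * int_autocorr n g (vzero n)"
proof -
  have "(of_int (\<Sum>y\<in>Z2_vec n. (int_walsh n g y)\<^sup>2) :: complex) = of_int (2 ^ n * int_autocorr n g (vzero n))"
    using sum_chi_walsh[OF vzero_closed, of n "\<lambda>x. of_int (g x)"]
    by (simp add: walsh_of_int autocorr_of_int power2_eq_square)
  then show ?thesis by (simp only: of_int_eq_iff)
qed

lemma int_autocorr_vzero:
  assumes "\<And>x. g x = 1 \<or> g x = -1"
  shows "int_autocorr n g (vzero n) = 2 ^ n"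
proof -
  have "g x * g x = 1" for x using assms[of x] by auto
  then show ?thesis by (simp add: int_autocorr_def)
qed

lemma abs_int_autocorr_le:
  assumes "\<And>x. g x = 1 \<or> g x = -1"
  shows "\<bar>int_autocorr n g a\<bar> \<le> 2 ^ n"
proof -
  have g: "\<bar>g x\<bar> = 1" for x using assms[of x] by auto
  have "\<bar>int_autocorr n g a\<bar> \<le> (\<Sum>x\<in>Z2_vec n. \<bar>g (vadd n x a) * g x\<bar>)"
    unfolding int_autocorr_def by (rule sum_abs)
  then show ?thesis by (simp add: abs_mult g)
qed

text \<open>Otherwise the square of the integer \<open>int_walsh n g (vzero n)\<close> would be
  \<open>2 ^ n\<close>.\<close>

lemma no_bent_odd:
  assumes "\<And>x. g x = 1 \<or> g x = -1" "odd n"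
  shows "\<exists>a\<in>Z2_vec n. a \<noteq> vzero n \<and> int_autocorr n g a \<noteq> 0"
proof (rule ccontr)
  assume "\<not> ?thesis"
  then have "(int_walsh n g (vzero n))\<^sup>2 = (\<Sum>a\<in>Z2_vec n. if a = vzero n then 2 ^ n else 0)"
    unfolding int_walsh_square using int_autocorr_vzero[OF assms(1)]
    by (intro sum.cong) (auto simp: chi_commute[of n "vzero n"])
  then have "(int_walsh n g (vzero n))\<^sup>2 = 2 ^ n" by simp
  then show False using square_eq_two_power_int assms(2) by blast
qed

text \<open>The product of \<open>g (vadd n x a) - 1\<close> and \<open>g x - 1\<close> is 0 or 4
  and is invariant under translation by \<open>a\<close>, so its sum is divisible by 8; expanding it
  gives the claim.\<close>

lemma int_autocorr_mod_8:
  assumes g: "\<And>x. g x = 1 \<or> g x = -1" and a: "a \<in> Z2_vec n" "a \<noteq> vzero n"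
  shows "8 dvd int_autocorr n g a - 2 * int_walsh n g (vzero n) + 2 ^ n"
proof -
  let ?h = "\<lambda>x. (g (vadd n x a) - 1) * (g x - 1)"
  have "2 * 4 dvd (\<Sum>x\<in>Z2_vec n. ?h x)"
  proof (rule sum_invariant_dvd[OF a])
    show "?h (vadd n x a) = ?h x" if "x \<in> Z2_vec n" for x
      using that by simp
    show "4 dvd ?h x" for x
      using g[of x] g[of "vadd n x a"] by auto
  qed
  have "(\<Sum>x\<in>Z2_vec n. ?h x) = int_autocorr n g a - (\<Sum>x\<in>Z2_vec n. g (vadd n x a)) - (\<Sum>x\<in>Z2_vec n. g x) + 2 ^ n"
    by (simp add: int_autocorr_def algebra_simps sum.distrib sum_subtractf)
  moreover have "(\<Sum>x\<in>Z2_vec n. g (vadd n x a)) = (\<Sum>x\<in>Z2_vec n. g x)"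
    by (rule sum_translate[OF a(1)])
  moreover have "int_walsh n g (vzero n) = (\<Sum>x\<in>Z2_vec n. g x)"
    by (simp add: int_walsh_def chi_commute[of n "vzero n"])
  ultimately have "int_autocorr n g a - 2 * int_walsh n g (vzero n) + 2 ^ n = (\<Sum>x\<in>Z2_vec n. ?h x)"
    by linarith
  with \<open>2 * 4 dvd (\<Sum>x\<in>Z2_vec n. ?h x)\<close> show ?thesis by simp
qed

lemma even_int_walsh:
  assumes "\<And>x. g x = 1 \<or> g x = -1" "n \<ge> 1"
  shows "even (int_walsh n g y)"
proof -
  have "odd (g x * chi n y x)" for x
    using assms(1)[of x] chi_cases[of n y x] by auto
  then have "even (\<Sum>x\<in>Z2_vec n. g x * chi n y x + 1)" by (intro dvd_sum) simp
  then have "even (int_walsh n g y + 2 ^ n)"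
    unfolding int_walsh_def sum.distrib by simp
  then show ?thesis using assms(2) by simp
qed

text \<open>Since \<open>z ^ (p ^ \<alpha>)\<close> is -1, raising the vanishing sum to the power
  \<open>p ^ \<alpha>\<close> turns it modulo \<open>p\<close> into a sum of signs.\<close>

lemma prime_dvd_sign_sum:
  fixes z :: complex
  assumes p: "prime p" "odd p"
    and z: "\<And>d. z powi d = 1 \<longleftrightarrow> int (2 * p ^ \<alpha>) dvd d"
    and vanish: "(\<Sum>x\<in>X. z powi e x) = 0"
  shows "int p dvd (\<Sum>x\<in>X. if even (e x) then 1 else -1)"
proof -
  let ?m = "2 * p ^ \<alpha>"
  let ?s = "(\<Sum>x\<in>X. if even (e x) then 1 else -1) :: int"
  have p0: "p > 0" using p prime_gt_0_nat by blast
  then have m0: "?m > 0" by simp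
  have "z powi int ?m = 1" by (simp only: z dvd_refl)
  then have zm: "z ^ ?m = 1" by (simp only: power_int_of_nat)
  have "z ^ (p ^ \<alpha>) = -1"
  proof -
    have "(z ^ (p ^ \<alpha>))\<^sup>2 = 1" using zm by (simp add: mult.commute flip: power_mult)
    moreover have "\<not> int ?m dvd int (p ^ \<alpha>)"
      using p0 by (simp only: int_dvd_int_iff) (auto dest: dvd_imp_le)
    then have "z ^ (p ^ \<alpha>) \<noteq> 1" by (metis power_int_of_nat z)
    ultimately show ?thesis by (simp add: power2_eq_1_iff)
  qed
  moreover obtain H where "ev (fam_poly ?m X (\<lambda>_. 1) e) z ^ (p ^ \<alpha>) =
      ev (fam_poly ?m X (\<lambda>_. 1) e) (z ^ (p ^ \<alpha>)) + of_nat p * ev H z"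
    using frobenius_ev[OF p(1)] .
  moreover have "ev (fam_poly ?m X (\<lambda>_. 1) e) z = 0"
    by (simp only: ev_fam_poly[OF zm m0] of_int_1 mult_1 vanish)
  moreover have "ev (fam_poly ?m X (\<lambda>_. 1) e) (-1) = (\<Sum>x\<in>X. (-1) powi e x)"
    by (subst ev_fam_poly) (use m0 in auto)
  moreover have "(\<Sum>x\<in>X. (-1) powi e x :: complex) = of_int ?s"
    unfolding of_int_sum by (intro sum.cong) (auto simp: power_int_minus_left)
  ultimately have "of_int ?s + of_nat p * ev H z = 0"
    using p0 by (simp add: power_0_left)
  then have "of_int ?s = of_int (int p) * ev (- H) z"
    by (simp add: add_eq_0_iff2)
  then show ?thesis by (rule int_dvd_if_eq_mult_ev[OF zm m0])
qed

lemma gbf_sign_function: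
  assumes p: "prime p" "odd p" and f: "generalized_bent (2 * p ^ \<alpha>) n f"
  obtains g :: "(nat \<Rightarrow> int) \<Rightarrow> int" where "\<And>x. g x = 1 \<or> g x = -1"
    "\<And>a. a \<in> Z2_vec n \<Longrightarrow> a \<noteq> vzero n \<Longrightarrow> int p dvd int_autocorr n g a"
proof -
  define g :: "(nat \<Rightarrow> int) \<Rightarrow> int" where "g x = (if even (f x) then 1 else -1)" for x
  have m0: "2 * p ^ \<alpha> > 0" using p prime_gt_0_nat by simp
  have "int p dvd int_autocorr n g a" if a: "a \<in> Z2_vec n" "a \<noteq> vzero n" for a
  proof -
    have "int_autocorr n g a = (\<Sum>x\<in>Z2_vec n. if even (f (vadd n x a) - f x) then 1 else -1)"
      unfolding int_autocorr_def by (intro sum.cong) (auto simp: g_def)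
    also have "int p dvd \<dots>"
      using f a by (intro prime_dvd_sign_sum[OF p zeta_powi_eq_1_iff[OF m0]])
        (auto simp: generalized_bent_iff)
    finally show ?thesis .
  qed
  moreover have "g x = 1 \<or> g x = -1" for x by (simp add: g_def)
  ultimately show thesis using that by blast
qed

lemma int_dvd_abs_less_imp_0:
  fixes c d :: int
  assumes "d dvd c" "\<bar>c\<bar> < d"
  shows "c = 0"
  using assms dvd_imp_le_int[of c d] by auto

lemma two_power_mult_dvd:
  assumes "odd p" "int p dvd c" "2 ^ k dvd c"
  shows "2 ^ k * int p dvd c"
proof -
  have "coprime (2 ^ k) (int p)" using assms(1) by simp
  with assms show ?thesis by (simp add: divides_mult)
qed

lemma no_gbf_large_prime:
  assumes n: "odd n" and p: "prime p" "odd p" and large: "2 ^ n < 4 * p"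
  shows "\<not> generalized_bent (2 * p ^ \<alpha>) n f"
proof
  assume "generalized_bent (2 * p ^ \<alpha>) n f"
  then obtain g where g: "\<And>x. g x = 1 \<or> g x = -1"
    "\<And>a. a \<in> Z2_vec n \<Longrightarrow> a \<noteq> vzero n \<Longrightarrow> int p dvd int_autocorr n g a"
    using gbf_sign_function[OF p] by metis
  from no_bent_odd[of g n, OF g(1) n]
  obtain a where a: "a \<in> Z2_vec n" "a \<noteq> vzero n" "int_autocorr n g a \<noteq> 0"
    by auto
  let ?C = "int_autocorr n g a"
  have le: "\<bar>?C\<bar> \<le> 2 ^ n" by (rule abs_int_autocorr_le[of g, OF g(1)])
  have large': "2 ^ n < 4 * int p"
    using large by (metis of_nat_less_iff of_nat_mult of_nat_numeral of_nat_power)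
  have "p \<ge> 3" using p prime_ge_2_nat[of p] by (cases "p = 2") auto
  show False
  proof (cases "n = 1")
    case True
    then have "\<bar>?C\<bar> < int p" using le \<open>p \<ge> 3\<close> by simp
    then show False using int_dvd_abs_less_imp_0[OF g(2)] a by blast
  next
    case False
    then have "n \<ge> 2" using n by (cases n) auto
    then obtain k where k: "n = Suc (Suc k)" by (metis Suc_le_D numeral_2_eq_2 Suc_le_mono)
    obtain j where j: "int_walsh n g (vzero n) = 2 * j"
      using even_int_walsh[of g n "vzero n", OF g(1)] \<open>n \<ge> 2\<close> by (auto elim: evenE)
    have "4 dvd ?C - 2 * int_walsh n g (vzero n) + 2 ^ n"
      using int_autocorr_mod_8[of g, OF g(1) a(1,2)] by (rule dvd_trans[rotated]) simp
    moreover have "?C = (?C - 2 * int_walsh n g (vzero n) + 2 ^ n) + 4 * (j - 2 ^ k)"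
      by (simp add: j) (simp add: k)
    ultimately have "4 dvd ?C" by (metis dvd_add dvd_triv_left)
    then have "4 * int p dvd ?C"
      using two_power_mult_dvd[of p ?C 2] p(2) g(2)[OF a(1,2)] by simp
    then show False using int_dvd_abs_less_imp_0[of "4 * int p" ?C] le large' a(3) by simp
  qed
qed

text \<open>
  If \<open>w\<^sub>0\<close> is the least value of \<open>\<bar>w\<bar>\<close>, then \<open>p = q - w\<^sub>0\<^sup>2\<close>, every \<open>\<bar>w y\<bar>\<close> has the form \<open>2pk \<plusminus> w\<^sub>0\<close>,
  and \<open>d y = ((w y)\<^sup>2 - w\<^sub>0\<^sup>2) / (4p)\<close> equals \<open>k(pk \<plusminus> w\<^sub>0)\<close>. The sum of the \<open>d y\<close> is \<open>p + w\<^sub>0\<^sup>2 < 2p\<close>,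
  which leaves room for at most two nonzero terms unless \<open>w\<^sub>0 = 1\<close>.
\<close>
lemma square_spectrum_forces_eq:
  fixes w S :: "'a \<Rightarrow> int" and p q :: int
  assumes V: "finite V" "V \<noteq> {}" "int (card V) = 4 * q"
    and p: "prime p" "odd p" and q: "even q" "q < 2 * p"
    and w: "\<And>y. y \<in> V \<Longrightarrow> (w y)\<^sup>2 = q + p * S y"
    and S: "\<And>y. y \<in> V \<Longrightarrow> odd (S y)"
    and sum: "(\<Sum>y\<in>V. (w y)\<^sup>2) = 4 * q * q"
  shows "p = q - 1"
proof -
  have p3: "p \<ge> 3" using p prime_ge_2_int[of p] by (cases "p = 2") auto
  have q0: "q > 0" using V by (metis card_gt_0_iff of_nat_0_less_iff zero_less_mult_pos zero_less_numeral)
  \<comment> \<open>The mean of the squares is \<open>q\<close>, so they cannot all be at least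
    \<open>q + p\<close>.\<close>
  have "\<exists>y\<in>V. S y \<le> 0"
  proof (rule ccontr)
    assume "\<not> ?thesis"
    then have "\<And>y. y \<in> V \<Longrightarrow> 1 \<le> S y" by force
    then have "p * 1 \<le> p * S y" if "y \<in> V" for y
      using that p3 by (intro mult_left_mono) auto
    then have "q + p \<le> (w y)\<^sup>2" if "y \<in> V" for y
      using that w by fastforce
    then have "(\<Sum>y\<in>V. q + p) \<le> 4 * q * q"
      unfolding sum [symmetric] by (intro sum_mono) auto
    then have "p * q \<le> 0" using V(3) by (simp add: distrib_left)
    moreover have "p * q > 0" using p3 q0 by simp
    ultimately show False by linarith
  qed
  then obtain y0 where y0: "y0 \<in> V" "S y0 \<le> 0" by blast
  have S_ge: "S y \<ge> -1" if y: "y \<in> V" for y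
  proof -
    have "p * S y > p * (-2)" using w[OF y] q zero_le_power2[of "w y"] by linarith
    then have "S y > -2" using p3 by (simp only: mult_less_cancel_left)
    then show ?thesis by simp
  qed
  have "S y0 = -1" using S_ge[OF y0(1)] y0(2) S[OF y0(1)] by (cases "S y0 = 0") auto
  define w0 where "w0 = \<bar>w y0\<bar>"
  have w0sq: "w0\<^sup>2 = q - p" using w[OF y0(1)] \<open>S y0 = -1\<close> by (simp add: w0_def)
  have odd_w: "odd (w y)" if "y \<in> V" for y
  proof -
    have "odd ((w y)\<^sup>2)" unfolding w[OF that] using q p S[OF that] by simp
    then show ?thesis by simp
  qed
  have w0: "odd w0" "w0 \<ge> 1" using odd_w[OF y0(1)] by (auto simp: w0_def intro: odd_pos) presburger
  have w0p: "w0\<^sup>2 + 1 \<le> p" using w0sq q by linarith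
  have "w0 * 1 \<le> w0 * w0" using w0 by (intro mult_left_mono) auto
  then have w0_less: "w0 < p" using w0p by (simp add: power2_eq_square)
  define d where "d y = (S y + 1) div 4" for y
  have d: "S y + 1 = 4 * d y \<and> (d y = 0 \<or> d y = p - w0 \<or> d y = p + w0 \<or> d y \<ge> 2 * p)" if y: "y \<in> V" for y
  proof -
    define v where "v = \<bar>w y\<bar>"
    have v: "v \<ge> 0" "odd v" using odd_w[OF y] by (auto simp: v_def)
    have prod: "(v - w0) * (v + w0) = p * (S y + 1)"
      using w[OF y] w0sq by (simp add: v_def algebra_simps power2_eq_square)
    then have "p dvd (v - w0) * (v + w0)" by simp
    then consider "p dvd v - w0" | "p dvd v + w0"
      using prime_dvd_multD[OF p(1)] by blast
    then show ?thesis
    proof cases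
      case 1
      \<comment> \<open>Both \<open>v\<close> and \<open>w0\<close> are odd, which supplies the
        factor 2; the other case gains it in the same way.\<close>
      then have "2 * p dvd v - w0"
        using p(2) v w0 by (intro divides_mult) auto
      then obtain k where k: "v = w0 + 2 * p * k" by (auto simp: dvd_def algebra_simps)
      have "k \<ge> 0"
      proof (rule ccontr)
        assume "\<not> k \<ge> 0"
        then have "p * k \<le> p * (-1)" using p3 by (intro mult_left_mono) auto
        then show False using k v w0_less p3 by (simp add: mult.assoc)
      qed
      have "p * (S y + 1) = p * (4 * (k * (p * k + w0)))"
        unfolding prod [symmetric] k by (simp add: algebra_simps)
      then have Sk: "S y + 1 = 4 * (k * (p * k + w0))" using p3 by simp
      then have dk: "d y = k * (p * k + w0)" by (simp add: d_def)
      have "d y \<ge> 2 * p" if "k \<ge> 2"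
      proof -
        have "p * 1 \<le> p * k" using that p3 by (intro mult_left_mono) auto
        then have "p \<le> p * k + w0" using w0 by linarith
        then have "2 * p \<le> k * (p * k + w0)" using that p3 by (intro mult_mono) linarith+
        then show ?thesis by (simp add: dk)
      qed
      moreover have "k = 0 \<or> k = 1 \<or> k \<ge> 2" using \<open>k \<ge> 0\<close> by linarith
      ultimately show ?thesis using Sk dk by auto
    next
      case 2
      then have "2 * p dvd v + w0"
        using p(2) v w0 by (intro divides_mult) auto
      then obtain k where k: "v = 2 * p * k - w0" by (metis dvd_def add_diff_cancel_right')
      have "k \<ge> 1"
      proof (rule ccontr)
        assume "\<not> k \<ge> 1"
        then have "p * k \<le> p * 0" using p3 by (intro mult_left_mono) auto
        then show False using k v w0 by (simp add: mult.assoc)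
      qed
      have "p * (S y + 1) = p * (4 * (k * (p * k - w0)))"
        unfolding prod [symmetric] k by (simp add: algebra_simps)
      then have Sk: "S y + 1 = 4 * (k * (p * k - w0))" using p3 by simp
      then have dk: "d y = k * (p * k - w0)" by (simp add: d_def)
      have "d y \<ge> 2 * p" if "k \<ge> 2"
      proof -
        have "p * 2 \<le> p * k" using that p3 by (intro mult_left_mono) auto
        then have "2 * p - w0 \<le> p * k - w0" by linarith
        then have "2 * (2 * p - w0) \<le> k * (p * k - w0)" using that w0_less w0 by (intro mult_mono) linarith+
        then show ?thesis using w0_less by (simp add: dk)
      qed
      moreover have "k = 1 \<or> k \<ge> 2" using \<open>k \<ge> 1\<close> by linarith
      ultimately show ?thesis using Sk dk by auto
    qed
  qed
  have "4 * q * q = (\<Sum>y\<in>V. q - p + 4 * p * d y)"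
    unfolding sum [symmetric]
  proof (rule sum.cong[OF refl])
    fix y assume y: "y \<in> V"
    have "S y = 4 * d y - 1" using d[OF y] by linarith
    then show "(w y)\<^sup>2 = q - p + 4 * p * d y" 
      unfolding w[OF y] by (simp only: right_diff_distrib)
  qed
  also have "\<dots> = 4 * q * (q - p) + 4 * p * (\<Sum>y\<in>V. d y)"
    using V(3) by (simp add: sum.distrib sum_distrib_left)
  finally have "4 * p * (\<Sum>y\<in>V. d y) = 4 * p * q" by (auto simp: algebra_simps)
  then have "(\<Sum>y\<in>V. d y) = q" using p3 by simp
  then have sum_d: "(\<Sum>y\<in>V. d y) = p + w0\<^sup>2" using w0sq by simp
  define D where "D = {y \<in> V. d y \<noteq> 0}"
  have finD: "finite D" using V by (simp add: D_def)
  have sum_D: "(\<Sum>y\<in>D. d y) = p + w0\<^sup>2"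
    unfolding sum_d [symmetric] D_def using V by (intro sum.mono_neutral_left) auto
  have dD: "d y = p - w0 \<or> d y = p + w0 \<or> d y \<ge> 2 * p" if "y \<in> D" for y
    using d[of y] that by (auto simp: D_def)
  have "w0 = 1"
  proof (rule ccontr)
    assume "w0 \<noteq> 1"
    then have w03: "w0 \<ge> 3" using w0 by presburger
    have "(\<Sum>y\<in>D. p - w0) \<le> (\<Sum>y\<in>D. d y)"
      using dD w0 p3 by (intro sum_mono) fastforce
    then have le: "int (card D) * (p - w0) \<le> p + w0\<^sup>2" by (simp add: sum_D)
    have "card D < 3"
    proof (rule ccontr)
      assume "\<not> card D < 3"
      then have "3 * (p - w0) \<le> int (card D) * (p - w0)"
        using w0_less by (intro mult_right_mono) auto
      then have "3 * (p - w0) \<le> p + w0\<^sup>2" using le by (rule order_trans)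
      then have "2 * p \<le> w0\<^sup>2 + 3 * w0" by (simp add: algebra_simps)
      with w0p have "w0\<^sup>2 + 2 \<le> 3 * w0" by linarith
      moreover have "3 * w0 \<le> w0\<^sup>2" using w03 by (simp add: power2_eq_square mult_right_mono)
      ultimately show False by simp
    qed
    then consider "card D = 0" | "card D = 1" | "card D = 2" by linarith
    then show False
    proof cases
      case 1
      then have "D = {}" using finD by simp
      then show False using sum_D p3 zero_le_power2[of w0] by (simp del: zero_le_power2)
    next
      case 2
      then obtain y where y: "D = {y}" by (auto simp: card_1_singleton_iff)
      then have dy: "d y = p + w0\<^sup>2" using sum_D by simp
      have sq: "w0\<^sup>2 > w0" using w03 by (simp add: power2_eq_square)
      \<comment> \<open>For \<open>w0 > 1\<close> the value \<open>p + w0\<^sup>2\<close> lies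
        strictly between \<open>p + w0\<close> and 2p, where \<open>d\<close> takes no
        value.\<close>
      show False using dD[of y] y dy sq w0p w0 by auto
    next
      case 3
      then obtain y y' where y: "D = {y, y'}" "y \<noteq> y'" by (auto simp: card_2_iff)
      then have "d y + d y' = p + w0\<^sup>2" using sum_D by simp
      moreover have "y \<in> D" "y' \<in> D" using y by auto
      \<comment> \<open>Any other pair of values sums to at least 2p, which is too much. The
        remaining pair factors \<open>p\<close> as \<open>w0 * (w0 + 2)\<close>.\<close>
      ultimately have "2 * p - 2 * w0 = p + w0\<^sup>2"
        using dD[of y] dD[of y'] w0p w0(2) w0_less by (elim disjE[OF dD] disjE) linarith+
      then have "p = w0 * (w0 + 2)" by (simp add: power2_eq_square algebra_simps)
      then have "w0 dvd p" by simp
      then show False using p(1) w03 w0_less unfolding prime_int_iff by (metis less_irrefl one_less_numeral_iff order_le_less_trans semiring_norm(77) zero_le_numeral order_trans not_le)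
    qed
  qed
  then show ?thesis using w0sq by simp
qed

text \<open>Modulo 8 all nontrivial autocorrelations agree, being either all divisible by 8p, hence
  zero, or all odd multiples of 4p. In the second case the halved Walsh values satisfy
  \<open>square_spectrum_forces_eq\<close> with \<open>q = 2 ^ (n - 2)\<close>.\<close>

lemma gbf_large_prime_mersenne:
  assumes n: "odd n" and p: "prime p" "odd p" and large: "2 ^ n < 8 * p"
    and f: "generalized_bent (2 * p ^ \<alpha>) n f"
  shows "mersenne_prime p"
proof (cases "n = 1")
  case True
  then have "(2::nat) ^ n < 4 * p" using prime_ge_2_nat[OF p(1)] by simp
  then show ?thesis using no_gbf_large_prime[OF n p] f by blast
next
  case False
  then have n3: "n \<ge> 3" using n by presburger
  then obtain k where k: "n = Suc (Suc (Suc k))"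
    by (metis add_Suc add_Suc_right le_Suc_ex numeral_3_eq_3 plus_nat.add_0)
  define q :: int where "q = 2 ^ (k + 1)"
  have n_q: "2 ^ n = 4 * q" by (simp add: k q_def)
  obtain g where g: "\<And>x. g x = 1 \<or> g x = -1"
    "\<And>a. a \<in> Z2_vec n \<Longrightarrow> a \<noteq> vzero n \<Longrightarrow> int p dvd int_autocorr n g a"
    using gbf_sign_function[OF p f] by metis
  define W where "W = int_walsh n g"
  define C where "C = int_autocorr n g"
  have C_le: "\<bar>C a\<bar> \<le> 2 ^ n" for a unfolding C_def by (rule abs_int_autocorr_le[of g, OF g(1)])
  have "int (2 ^ n) < int (8 * p)" using large by (simp only: of_nat_less_iff)
  then have large': "2 ^ n < 8 * int p" by simp
  obtain j where j: "W (vzero n) = 2 * j"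
    using even_int_walsh[of g n "vzero n", OF g(1)] n3 by (auto simp: W_def elim: evenE)
  have C8: "8 dvd C a - 4 * j" if a: "a \<in> Z2_vec n" "a \<noteq> vzero n" for a
  proof -
    have "8 dvd C a - 2 * (2 * j) + 2 ^ n"
      using int_autocorr_mod_8[of g, OF g(1) a] by (simp only: W_def [symmetric] C_def [symmetric] j)
    moreover have "8 dvd (2 :: int) ^ n" by (simp add: k)
    ultimately show ?thesis by (simp add: dvd_add_left_iff)
  qed
  have odd_j: "odd j"
  proof
    assume "even j"
    then have "8 dvd 4 * j" by auto
    then have "2 ^ 3 dvd C a" if "a \<in> Z2_vec n" "a \<noteq> vzero n" for a
      using C8[OF that] by (simp add: dvd_diff_left_iff)
    then have "2 ^ 3 * int p dvd C a" if "a \<in> Z2_vec n" "a \<noteq> vzero n" for a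
      using that g(2) p(2) two_power_mult_dvd[of p "C a" 3] by (auto simp: C_def)
    then have "C a = 0" if "a \<in> Z2_vec n" "a \<noteq> vzero n" for a
      using that int_dvd_abs_less_imp_0[of "2 ^ 3 * int p" "C a"] C_le[of a] large' by simp
    then show False using no_bent_odd[of g n, OF g(1) n] by (auto simp: C_def)
  qed
  define \<epsilon> where "\<epsilon> a = C a div (4 * int p)" for a
  have C_eps: "C a = 4 * int p * \<epsilon> a" "odd (\<epsilon> a)" if a: "a \<in> Z2_vec n" "a \<noteq> vzero n" for a
  proof -
    obtain i where i: "C a = 4 * j + 8 * i" using C8[OF a] by (metis add.commute diff_eq_eq dvd_def)
    then have "2 ^ 2 dvd C a" by simp
    then have "4 * int p dvd C a"
      using g(2)[OF a] p(2) two_power_mult_dvd[of p "C a" 2] by (simp add: C_def)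
    then show C: "C a = 4 * int p * \<epsilon> a" by (simp add: \<epsilon>_def)
    have "int p * \<epsilon> a = j + 2 * i" using C i by simp
    then have "odd (int p * \<epsilon> a)" using odd_j by simp
    then show "odd (\<epsilon> a)" by simp
  qed
  define S where "S y = (\<Sum>a\<in>Z2_vec n - {vzero n}. chi n y a * \<epsilon> a)" for y
  have W2: "(W y)\<^sup>2 = 4 * (q + int p * S y)" for y
  proof -
    have "(W y)\<^sup>2 = (\<Sum>a\<in>Z2_vec n. chi n y a * C a)"
      unfolding W_def C_def by (rule int_walsh_square)
    also have "\<dots> = C (vzero n) + (\<Sum>a\<in>Z2_vec n - {vzero n}. chi n y a * C a)"
      by (subst sum.remove[of _ "vzero n"]) simp_all
    also have "(\<Sum>a\<in>Z2_vec n - {vzero n}. chi n y a * C a) = 4 * int p * S y"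
      unfolding S_def sum_distrib_left by (intro sum.cong) (simp_all add: C_eps(1))
    also have "C (vzero n) = 4 * q" unfolding C_def by (simp add: int_autocorr_vzero[of g, OF g(1)] n_q)
    finally show ?thesis by (simp add: algebra_simps)
  qed
  define w where "w y = W y div 2" for y
  have Ww: "W y = 2 * w y" for y
    using even_int_walsh[of g n y, OF g(1)] n3 by (simp add: W_def w_def)
  have w2: "(w y)\<^sup>2 = q + int p * S y" for y
    using W2[of y] by (simp add: Ww power_mult_distrib)
  have S_odd: "odd (S y)" for y
  proof -
    have "odd (chi n y a)" for a using chi_cases[of n y a] by auto
    then have "even (\<Sum>a\<in>Z2_vec n - {vzero n}. chi n y a * \<epsilon> a + 1)"
      using C_eps(2) by (intro dvd_sum) simp
    moreover have "card (Z2_vec n - {vzero n}) = 2 ^ n - 1" by simp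
    moreover have "odd (int (2 ^ n - 1))" using n3 by simp
    ultimately show ?thesis unfolding S_def sum.distrib by simp
  qed
  have "(\<Sum>y\<in>Z2_vec n. (W y)\<^sup>2) = 2 ^ n * 2 ^ n"
    unfolding W_def int_parseval by (simp add: int_autocorr_vzero[of g, OF g(1)])
  then have "4 * (\<Sum>y\<in>Z2_vec n. (w y)\<^sup>2) = 4 * (4 * q * q)"
    by (simp add: Ww power_mult_distrib n_q sum_distrib_left)
  then have sum_w: "(\<Sum>y\<in>Z2_vec n. (w y)\<^sup>2) = 4 * q * q" by simp
  have "int p = q - 1"
  proof (rule square_spectrum_forces_eq[where S = S, OF _ _ _ _ _ _ _ _ _ sum_w])
    show "Z2_vec n \<noteq> {}" using vzero_closed by blast
    show "int (card (Z2_vec n)) = 4 * q" by (simp add: n_q)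
    show "prime (int p)" "odd (int p)" using p by simp_all
    show "even q" by (simp add: q_def)
    show "q < 2 * int p" using large' n_q by simp
  qed (simp_all add: w2 S_odd)
  then have "int p = int (2 ^ (k + 1) - 1)" by (simp add: q_def of_nat_diff)
  then have "p = 2 ^ (k + 1) - 1" by (simp only: of_nat_eq_iff)
  then show ?thesis using p(1) unfolding mersenne_prime_def by blast
qed

section \<open>Primes congruent to 3 or 5 modulo 8\<close>

text \<open>
  For \<open>\<tau> = \<zeta>\<^sub>8 + \<zeta>\<^sub>8\<^sup>-\<^sup>1\<close> one has \<open>\<tau>\<^sup>2 = 2\<close>, and \<open>\<tau>\<^sup>p\<close> is congruent to \<open>\<zeta>\<^sub>8\<^sup>p + \<zeta>\<^sub>8\<^sup>-\<^sup>p = -\<tau>\<close> modulo \<open>p\<close>.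
\<close>
lemma two_power_cong_minus_one:
  assumes p: "prime p" and p8: "[p = 3] (mod 8) \<or> [p = 5] (mod 8)"
  shows "[2 ^ ((p - 1) div 2) = -1] (mod int p)"
proof -
  define z where "z = zeta 8"
  have z8: "z powi d = 1 \<longleftrightarrow> 8 dvd d" for d
    using zeta_powi_eq_1_iff[of 8 d] by (simp add: z_def)
  have "z ^ 8 = 1" using z8[of 8] by simp
  have "z ^ 4 = -1"
  proof -
    have "(z ^ 4)\<^sup>2 = 1" using \<open>z ^ 8 = 1\<close> by (simp flip: power_mult)
    moreover have "z ^ 4 \<noteq> 1" using z8[of 4] by simp
    ultimately show ?thesis using power2_eq_1_iff by blast
  qed
  \<comment> \<open>As \<open>z ^ 4\<close> is -1, the inverse of \<open>z\<close> is
    \<open>- (z ^ 3)\<close>; so X - X^3 represents the square root of 2 as a polynomial in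
    \<open>z\<close>.\<close>
  define Q :: "int poly" where "Q = monom 1 1 - monom 1 3"
  have evQ: "ev Q u = u - u ^ 3" for u by (simp add: Q_def)
  have t2: "(ev Q z)\<^sup>2 = 2"
  proof -
    have "(ev Q z)\<^sup>2 = z\<^sup>2 - 2 * z ^ 4 + z ^ 4 * z\<^sup>2"
      unfolding evQ by (simp add: power2_eq_square power4_eq_xxxx power3_eq_cube algebra_simps)
    then show ?thesis by (simp add: \<open>z ^ 4 = -1\<close>)
  qed
  obtain H where H: "ev Q z ^ p = ev Q (z ^ p) + of_nat p * ev H z"
    using frobenius_ev[OF p, where Q = Q and i = 1 and z = z] by auto
  have zp: "ev Q (z ^ p) = - ev Q z"
  proof -
    have zc: "z ^ i = z ^ (i mod 8)" for i
    proof -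
      have "z ^ i = z ^ (8 * (i div 8) + i mod 8)" by simp
      also have "\<dots> = z ^ (i mod 8)" by (simp only: power_add power_mult \<open>z ^ 8 = 1\<close> power_one mult_1)
      finally show ?thesis .
    qed
    have "z ^ 9 = z" using zc[of 9] by simp
    have "z ^ 5 = z ^ 4 * z" "z ^ 15 = z ^ 8 * (z ^ 4 * z ^ 3)"
      by (simp_all flip: power_add power_Suc2)
    then have "z ^ 5 = - z" "z ^ 15 = - (z ^ 3)"
      using \<open>z ^ 4 = -1\<close> \<open>z ^ 8 = 1\<close> by simp_all
    from p8 show ?thesis
    proof
      assume "[p = 3] (mod 8)"
      then have "z ^ p = z ^ 3" using zc[of p] by (simp add: cong_def)
      then show ?thesis unfolding evQ \<open>z ^ p = z ^ 3\<close> by (simp add: \<open>z ^ 9 = z\<close> flip: power_mult)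
    next
      assume "[p = 5] (mod 8)"
      then have "z ^ p = z ^ 5" using zc[of p] by (simp add: cong_def)
      then show ?thesis unfolding evQ \<open>z ^ p = z ^ 5\<close>
        by (simp add: \<open>z ^ 15 = - (z ^ 3)\<close> \<open>z ^ 5 = - z\<close>)
    qed
  qed
  have odd_p: "odd p" using p8 by (auto simp: cong_def) presburger+
  define h where "h = (p - 1) div 2"
  have ph: "p + 1 = 2 * (h + 1)" using odd_p by (auto simp: h_def elim: oddE)
  have "(2 :: complex) ^ (h + 1) = ev Q z ^ (p + 1)"
    unfolding ph power_mult t2 ..
  also have "\<dots> = (- ev Q z + of_nat p * ev H z) * ev Q z"
    by (simp add: H zp)
  also have "\<dots> = - 2 + of_nat p * ev (H * Q) z"
    using t2 by (simp add: algebra_simps power2_eq_square)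
  finally have "of_int (2 ^ (h + 1) + 2) = of_int (int p) * ev (H * Q) z" by simp
  then have "int p dvd 2 ^ (h + 1) + 2"
    by (rule int_dvd_if_eq_mult_ev[OF \<open>z ^ 8 = 1\<close>, rotated]) simp
  then have "int p dvd 2 * (2 ^ h - (- 1))" by simp
  moreover have "coprime (int p) 2" using odd_p by simp
  ultimately have "int p dvd 2 ^ h - (- 1)" using coprime_dvd_mult_right_iff by blast
  then show ?thesis by (simp add: cong_iff_dvd_diff h_def)
qed

text \<open>In \<open>a ^ p - b ^ p\<close> the cofactor of \<open>a - b\<close> is a sum of
  \<open>p\<close> terms, all congruent to \<open>b ^ (p - 1)\<close> modulo \<open>p\<close>; it
  contributes the extra factor \<open>p\<close>.\<close>

lemma cong_power_prime:
  fixes a b :: int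
  assumes p: "prime p" and ab: "[a = b] (mod int (p ^ k))" and k: "k > 0"
  shows "[a ^ p = b ^ p] (mod int (p ^ Suc k))"
proof -
  have "int p dvd int (p ^ k)" using k by simp
  then have abp: "[a = b] (mod int p)" using ab by (meson cong_dvd_modulus)
  have "[(\<Sum>i<p. b ^ (p - Suc i) * a ^ i) = (\<Sum>i<p. b ^ (p - Suc i) * b ^ i)] (mod int p)"
    by (intro cong_sum cong_mult cong_pow abp cong_refl)
  also have "(\<Sum>i<p. b ^ (p - Suc i) * b ^ i) = (\<Sum>i<p. b ^ (p - 1))"
    by (intro sum.cong) (auto simp flip: power_add)
  also have "\<dots> = int p * b ^ (p - 1)" by simp
  also have "[int p * b ^ (p - 1) = 0] (mod int p)" by (simp add: cong_0_iff)
  finally have "int p dvd (\<Sum>i<p. b ^ (p - Suc i) * a ^ i)" by (simp add: cong_0_iff)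
  moreover have "int (p ^ k) dvd a - b" using ab by (simp add: cong_iff_dvd_diff)
  ultimately have "int (p ^ k) * int p dvd (a - b) * (\<Sum>i<p. b ^ (p - Suc i) * a ^ i)"
    by (intro mult_dvd_mono)
  then show ?thesis by (simp add: cong_iff_dvd_diff power_diff_sumr2 mult.commute)
qed

lemma exists_two_power_cong_minus_one:
  assumes p: "prime p" and p8: "[p = 3] (mod 8) \<or> [p = 5] (mod 8)"
  shows "\<exists>j. [2 ^ j = -1] (mod int (p ^ Suc k))"
proof (induction k)
  case 0
  then show ?case using two_power_cong_minus_one[OF p p8] by auto
next
  case (Suc k)
  then obtain j where "[2 ^ j = -1] (mod int (p ^ Suc k))" by blast
  then have "[(2 ^ j) ^ p = (-1) ^ p] (mod int (p ^ Suc (Suc k)))"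
    by (intro cong_power_prime p) auto
  moreover have "odd p" using p8 by (auto simp: cong_def) presburger+
  ultimately show ?case by (auto simp flip: power_mult)
qed

text \<open>
  The prime 2 is self-conjugate: conjugation on \<open>\<int>[w]\<close> is a power of the Frobenius at 2. Hence
  \<open>X cnj X\<close> even forces a power of \<open>X\<close>, and then \<open>X\<close> itself, to be divisible by 2.
\<close>
lemma self_conjugate_norm_even_exponent:
  fixes w :: complex
  assumes wM: "w ^ M = 1" "odd M" and cnj: "w ^ (2 ^ j) = cnj w"
    and X: "ev Q w * cnj (ev Q w) = 2 ^ n"
  shows "even n"
  using X
proof (induction n arbitrary: Q rule: less_induct)
  case (less n)
  have M0: "M > 0" using wM(2) by (auto intro: odd_pos)
  show ?case
  proof (cases "n = 0")
    case False
    define L where "L = (2::nat) ^ j"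
    obtain H where H: "ev Q w ^ L = ev Q (w ^ L) + 2 * ev H w"
      using frobenius_ev[of 2 Q w j] by (auto simp: L_def)
    have wL: "ev Q (w ^ L) = cnj (ev Q w)" by (simp add: L_def cnj cnj_ev)
    have "ev Q w ^ Suc L = ev Q w * cnj (ev Q w) + 2 * (ev Q w * ev H w)"
      by (simp add: H wL algebra_simps)
    also have "\<dots> = 2 * ev (2 ^ (n - 1) + Q * H) w"
    proof -
      have "ev (2 ^ (n - 1)) w = 2 ^ (n - 1)"
        using ev_of_int[of "2 ^ (n - 1)" w] by simp
      moreover have "(2::complex) ^ n = 2 * 2 ^ (n - 1)" using False by (simp flip: power_Suc)
      ultimately show ?thesis by (simp add: less.prems distrib_left)
    qed
    finally have XL: "ev Q w ^ Suc L = 2 * ev (2 ^ (n - 1) + Q * H) w" .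
    \<comment> \<open>The exponent makes \<open>2 ^ t\<close> congruent to 1 modulo
      \<open>M\<close>, so this Frobenius power fixes \<open>w\<close>, and large enough that the
      \<open>2 ^ t\<close>-th power contains the even power found above. Hence the value itself is
      even.\<close>
    define t where "t = totient M * Suc L"
    have "totient M \<ge> 1" using M0 by (simp add: Suc_le_eq)
    then have "1 * Suc L \<le> t" unfolding t_def by (rule mult_le_mono1)
    then have "Suc L \<le> t" by simp
    then have "Suc L \<le> 2 ^ t" using less_exp[of t] by linarith
    have "[2 ^ totient M = 1] (mod M)" using wM(2) by (intro euler_theorem) simp
    then have "[(2 ^ totient M) ^ Suc L = 1 ^ Suc L] (mod M)" by (rule cong_pow)
    then have c: "[2 ^ t = 1] (mod M)" by (simp only: t_def power_mult power_one)
    have w2t: "w ^ (2 ^ t) = w"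
    proof -
      have "w ^ i = w ^ (i mod M)" for i
      proof -
        have "w ^ i = w ^ (M * (i div M) + i mod M)" by simp
        also have "\<dots> = w ^ (i mod M)" by (simp only: power_add power_mult wM power_one mult_1)
        finally show ?thesis .
      qed
      from this[of "2 ^ t"] this[of 1] c show ?thesis by (simp add: cong_def)
    qed
    obtain H' where H': "ev Q w ^ (2 ^ t) = ev Q (w ^ (2 ^ t)) + 2 * ev H' w"
      using frobenius_ev[of 2 Q w t] by auto
    have "ev Q w ^ (2 ^ t) = ev Q w ^ Suc L * ev Q w ^ (2 ^ t - Suc L)"
      using \<open>Suc L \<le> 2 ^ t\<close> by (simp only: power_add [symmetric] le_add_diff_inverse)
    also have "\<dots> = 2 * ev ((2 ^ (n - 1) + Q * H) * Q ^ (2 ^ t - Suc L)) w"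
      unfolding XL ev_mult ev_power by (simp only: mult.assoc)
    finally have "ev Q w = 2 * (ev ((2 ^ (n - 1) + Q * H) * Q ^ (2 ^ t - Suc L)) w - ev H' w)"
      using H' w2t by (simp only: right_diff_distrib) (simp add: algebra_simps)
    then obtain R where R: "ev Q w = 2 * ev R w" by (metis ev_diff)
    have YY: "4 * (ev R w * cnj (ev R w)) = 2 ^ n" using less.prems by (simp add: R)
    \<comment> \<open>Otherwise 2 would divide 1 in Z[w]; the conjugate stays in that ring because
      it is the substitution of \<open>w ^ L\<close>.\<close>
    have "n \<noteq> 1"
    proof
      assume "n = 1"
      then have "of_int 1 = of_int 2 * (ev R w * cnj (ev R w))" using YY by simp
      also have "cnj (ev R w) = ev (pcompose R (monom 1 L)) w"
        by (simp add: cnj_ev L_def cnj)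
      finally have "of_int 1 = of_int 2 * ev (R * pcompose R (monom 1 L)) w" by simp
      then have "(2::int) dvd 1" by (rule int_dvd_if_eq_mult_ev[OF wM(1) M0])
      then show False by simp
    qed
    with False obtain k where k: "n = Suc (Suc k)" by (metis One_nat_def not0_implies_Suc)
    have "ev R w * cnj (ev R w) = 2 ^ k" using YY by (simp add: k)
    then have "even k" by (rule less.IH[rotated]) (simp add: k)
    then show ?thesis by (simp add: k)
  qed simp
qed

text \<open>The negative of \<zeta> is a root of unity of odd order dividing
  \<open>p ^ \<alpha>\<close>. The transform at zero lies in the ring it generates, and conjugation
  there is a Frobenius power at 2.\<close>

lemma no_gbf_two_nonresidue:
  assumes n: "odd n" and p: "prime p" "odd p" and a: "\<alpha> > 0"
    and p8: "[p = 3] (mod 8) \<or> [p = 5] (mod 8)"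
  shows "\<not> generalized_bent (2 * p ^ \<alpha>) n f"
proof
  assume f: "generalized_bent (2 * p ^ \<alpha>) n f"
  let ?M = "p ^ \<alpha>"
  let ?z = "zeta (2 * ?M)"
  have p0: "p > 0" using p prime_gt_0_nat by blast
  have M: "odd ?M" "?M > 0" using p p0 by simp_all
  have zM: "?z ^ ?M = -1"
    using p0 by (simp add: zeta_eq_cis DeMoivre)
  define w where "w = - ?z"
  have wM: "w ^ ?M = 1" using M(1) by (simp add: w_def zM)
  obtain j where j: "[2 ^ j = -1] (mod int ?M)"
    using exists_two_power_cong_minus_one[OF p(1) p8, of "\<alpha> - 1"] a by auto
  have "w ^ (2 ^ j) = cnj w"
  proof -
    have "w powi (2 ^ j) = w powi (-1)"
      using power_nat_mod[OF wM M(2), of "2 ^ j"] power_nat_mod[OF wM M(2), of "-1"] j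
      by (simp only: cong_def)
    moreover have "w powi (2 ^ j) = w ^ (2 ^ j)"
      using power_int_of_nat[of w "2 ^ j"] by simp
    ultimately show ?thesis by (simp add: w_def cnj_zeta power_int_minus)
  qed
  \<comment> \<open>Passing from \<zeta> to \<open>w\<close> moves the sign (-1)^f into the
    coefficients.\<close>
  define Q where "Q = fam_poly ?M (Z2_vec n) (\<lambda>x. (-1) ^ nat (f x)) f"
  have "ev Q w = gbf_transform (2 * ?M) n f (vzero n)"
  proof -
    have "of_int ((-1) ^ nat (f x)) * w powi f x = ?z powi f x" if "x \<in> Z2_vec n" for x
    proof -
      have "f x \<ge> 0" using f that by (auto simp: generalized_bent_iff)
      then obtain i where "f x = int i" using nonneg_int_cases by blast
      then show ?thesis by (simp add: w_def flip: power_mult_distrib)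
    qed
    moreover have "chi n (vzero n) x = 1" for x by (simp add: chi_commute[of n "vzero n"])
    ultimately show ?thesis
      by (simp add: Q_def ev_fam_poly[OF wM M(2)] gbf_transform_eq_walsh walsh_def)
  qed
  then have "ev Q w * cnj (ev Q w) = of_real ((cmod (gbf_transform (2 * ?M) n f (vzero n)))\<^sup>2)"
    by (simp only: complex_norm_square)
  moreover have "(cmod (gbf_transform (2 * ?M) n f (vzero n)))\<^sup>2 = 2 ^ n"
    using f by (simp add: generalized_bent_def)
  ultimately have "ev Q w * cnj (ev Q w) = 2 ^ n"
    by (simp only: of_real_power of_real_numeral)
  with \<open>w ^ (2 ^ j) = cnj w\<close> have "even n"
    using self_conjugate_norm_even_exponent[OF wM M(1)] by blast
  with n show False by simp
qed

section \<open>Elimination of large primes\<close>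

lemma zeta_mult_power: "a > 0 \<Longrightarrow> zeta (a * b) ^ a = zeta b"
  by (simp add: zeta_eq_cis DeMoivre)

text \<open>Discarding the \<open>p\<close>-part sends each autocorrelation to its
  \<open>w\<close>-component, which still vanishes by \<open>projection_vanishing\<close>.\<close>

lemma gbf_reduce:
  assumes p: "prime p" "odd p" and a: "\<alpha> > 0" and M: "odd M" and cop: "coprime p M"
    and P: "P \<le> p" "\<And>q. prime q \<Longrightarrow> q dvd M \<Longrightarrow> P \<le> q"
    and n: "n \<ge> 1" and len: "2 ^ n + 2 < p + P"
    and f: "generalized_bent (p ^ \<alpha> * (2 * M)) n f"
  shows "\<exists>g. generalized_bent (2 * M) n g"
proof -
  let ?m = "p ^ \<alpha> * (2 * M)"
  have M0: "M > 0" using M by (auto intro: odd_pos)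
  have p0: "p > 0" using p prime_gt_0_nat by blast
  have m0: "?m > 0" and N0: "2 * M > 0" using M0 p0 by simp_all
  have "coprime p (2 * M)" using cop p by simp
  then obtain a b where bez: "int (2 * M) * a + int (p ^ \<alpha>) * b = 1"
    by (rule bezout_prime_power)
  define w where "w = zeta ?m powi (int (p ^ \<alpha>) * b)"
  \<comment> \<open>Here \<open>w\<close> is the \<open>b\<close>-th power of
    \<open>zeta (2 * M)\<close>, so the projected function has exponents
    \<open>b * f x\<close>.\<close>
  define g where "g x = b * f x mod int (2 * M)" for x
  have "zeta ?m powi int (p ^ \<alpha>) = zeta (2 * M)"
    using p0 by (simp only: power_int_of_nat zeta_mult_power zero_less_power)
  then have w: "w powi i = zeta (2 * M) powi (b * i)" for i
    by (simp only: w_def power_int_mult)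
  have cong: "zeta (2 * M) powi i = zeta (2 * M) powi j" if "[i = j] (mod int (2 * M))" for i j
  proof -
    have "zeta (2 * M) powi (i - j) = 1"
      using that by (simp only: zeta_powi_eq_1_iff[OF N0] cong_iff_dvd_diff)
    then show ?thesis by (simp add: power_int_diff)
  qed
  have "(\<Sum>x\<in>Z2_vec n. zeta (2 * M) powi (g (vadd n x a) - g x)) = 0"
    if a': "a \<in> Z2_vec n" "a \<noteq> vzero n" for a
  proof -
    have "zeta (2 * M) powi (g (vadd n x a) - g x) = w powi (f (vadd n x a) - f x)" for x
    proof -
      have "[g (vadd n x a) - g x = b * f (vadd n x a) - b * f x] (mod int (2 * M))"
        unfolding g_def by (intro cong_diff) simp_all
      then show ?thesis unfolding w right_diff_distrib by (rule cong)
    qed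
    moreover have "(\<Sum>x\<in>Z2_vec n. w powi (f (vadd n x a) - f x)) = 0"
      using f a' n len
      by (intro projection_vanishing[OF p \<open>\<alpha> > 0\<close> M cop zeta_powi_eq_1_iff[OF m0] P _ _ _ _ bez w_def])
        (auto simp: generalized_bent_iff)
    ultimately show ?thesis by simp
  qed
  moreover have "g \<in> Z2_vec n \<rightarrow> {0..int (2 * M) - 1}"
    using N0 by (auto simp: g_def simp del: of_nat_mult)
  ultimately show ?thesis unfolding generalized_bent_iff by blast
qed

text \<open>Downward induction removes the largest remaining prime; \<open>p 1\<close> bounds the
  smaller ones from below at every stage.\<close>

lemma gbf_eliminate_primes:
  fixes p \<alpha> :: "nat \<Rightarrow> nat"
  assumes n: "n \<ge> 1"
    and p: "\<And>i. i \<in> {1..s} \<Longrightarrow> prime (p i) \<and> odd (p i)"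
    and mono: "strict_mono_on {1..s} p"
    and \<alpha>: "\<And>i. i \<in> {1..s} \<Longrightarrow> \<alpha> i > 0"
    and large: "\<And>i. i \<in> {r + 1..s} \<Longrightarrow> p i + p 1 > 2 ^ n + 2"
    and "r \<le> s" and "\<exists>f. generalized_bent (2 * (\<Prod>i=1..s. p i ^ \<alpha> i)) n f"
  shows "\<exists>f. generalized_bent (2 * (\<Prod>i=1..r. p i ^ \<alpha> i)) n f"
proof -
  have mono_le: "p i \<le> p j" if "i \<in> {1..s}" "j \<in> {1..s}" "i \<le> j" for i j
  proof (cases "i = j")
    case False
    then show ?thesis using strict_mono_onD[OF mono that(1,2)] that(3) by simp
  qed simp
  show ?thesis
    using \<open>r \<le> s\<close>
  proof (induction rule: inc_induct)
    case base
    then show ?case using assms(7) by simp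
  next
    case (step t)
    let ?M = "\<Prod>i=1..t. p i ^ \<alpha> i"
    let ?p = "p (Suc t)" and ?a = "\<alpha> (Suc t)"
    obtain f where f: "generalized_bent (2 * (\<Prod>i=1..Suc t. p i ^ \<alpha> i)) n f"
      using step by auto
    have t: "Suc t \<in> {1..s}" using step by simp
    have "2 * (\<Prod>i=1..Suc t. p i ^ \<alpha> i) = ?p ^ ?a * (2 * ?M)" by (simp add: mult_ac)
    then have f': "generalized_bent (?p ^ ?a * (2 * ?M)) n f" using f by (simp only:)
    have div: "\<exists>i\<in>{1..t}. q = p i" if q: "prime q" "q dvd ?M" for q
    proof -
      obtain i where i: "i \<in> {1..t}" "q dvd p i ^ \<alpha> i"
        using q by (auto simp: prime_dvd_prod_iff)
      then have "q dvd p i" using q(1) by (meson prime_dvd_power)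
      moreover have "prime (p i)" using p[of i] i(1) t by auto
      ultimately show ?thesis using q(1) i(1) primes_dvd_imp_eq by blast
    qed
    have "odd ?M" using p t by (auto simp: even_prod_iff)
    moreover have "coprime ?p ?M"
    proof (rule ccontr)
      assume "\<not> coprime ?p ?M"
      then have "?p dvd ?M" using p[OF t] prime_imp_coprime by blast
      then obtain i where i: "i \<in> {1..t}" "?p = p i" using div p[OF t] by blast
      then have "p i < ?p" using t by (intro strict_mono_onD[OF mono]) auto
      then show False using i by simp
    qed
    moreover have "p 1 \<le> ?p" using mono_le[of 1 "Suc t"] t by auto
    moreover have "p 1 \<le> q" if "prime q" "q dvd ?M" for q
      using div[OF that] mono_le[of 1] t by auto
    moreover have "2 ^ n + 2 < ?p + p 1" using large[of "Suc t"] step by auto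
    ultimately show ?case
      using gbf_reduce[OF _ _ \<alpha>[OF t] _ _ _ _ n _ f'] p[OF t] by blast
  qed
qed

text \<open>The exponent may be negative, as for \<open>n = 1\<close>, so the real bounds are
  cleared of denominators before natural-number lemmas apply.\<close>

lemma powi_two_less_iff:
  "2 powi (int n - int k) < real q \<longleftrightarrow> 2 ^ n < 2 ^ k * q"
proof -
  have "2 powi (int n - int k) = (2 ^ n / 2 ^ k :: real)"
    by (simp add: power_int_diff)
  then have "2 powi (int n - int k) < real q \<longleftrightarrow> (2 ^ n / 2 ^ k :: real) < real q"
    by (simp only:)
  also have "\<dots> \<longleftrightarrow> (2 ^ n :: real) < 2 ^ k * real q"
    by (simp add: pos_divide_less_eq mult.commute)
  also have "\<dots> \<longleftrightarrow> real (2 ^ n) < real (2 ^ k * q)" by simp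
  finally show ?thesis by (simp only: of_nat_less_iff)
qed

theorem corollary3p9:
  fixes n m s :: nat and p \<alpha> :: "nat \<Rightarrow> nat"
  assumes "n \<ge> 1" and "odd n"
    and "s \<ge> 1"
    and "\<And>i. i \<in> {1..s} \<Longrightarrow> prime (p i) \<and> odd (p i)"
    and "strict_mono_on {1..s} p"
    and "\<And>i. i \<in> {1..s} \<Longrightarrow> \<alpha> i > 0"
    and "m = 2 * (\<Prod>i=1..s. p i ^ \<alpha> i)"
  shows
    "(s = 1 \<longrightarrow>
        (real (p 1) > 2 powi (int n - 2)
         \<or> (\<not> mersenne_prime (p 1) \<and> real (p 1) > 2 powi (int n - 3))
         \<or> ([p 1 = 3] (mod 8) \<or> [p 1 = 5] (mod 8))) \<longrightarrow>
        \<not> (\<exists>f. generalized_bent m n f))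
     \<and> (s \<ge> 2 \<longrightarrow>
        (\<forall>r. r \<le> s - 1 \<and> p (r + 1) + p 1 > 2 ^ n + 2
             \<and> (\<forall>r'. r' \<le> s - 1 \<and> p (r' + 1) + p 1 > 2 ^ n + 2 \<longrightarrow> r \<le> r') \<longrightarrow>
           \<not> (\<exists>f. generalized_bent (2 * (\<Prod>i=1..r. p i ^ \<alpha> i)) n f) \<longrightarrow>
           \<not> (\<exists>f. generalized_bent m n f)))
     \<and> (s \<ge> 2 \<longrightarrow>
        real (p 1) > 2 powi (int n - 2) \<and> p 1 + p 2 > 2 ^ n + 2 \<longrightarrow>
        \<not> (\<exists>f. generalized_bent m n f))"
proof -
  have p1: "prime (p 1)" "odd (p 1)" and a1: "\<alpha> 1 > 0"
    using assms(3,4,6) by auto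
  \<comment> \<open>Monotonicity extends the size condition from \<open>p (r + 1)\<close> to all
    later primes.\<close>
  have reduce: "\<exists>f. generalized_bent (2 * (\<Prod>i=1..r. p i ^ \<alpha> i)) n f"
    if r: "r < s" "p (r + 1) + p 1 > 2 ^ n + 2" and f: "\<exists>f. generalized_bent m n f" for r
  proof (rule gbf_eliminate_primes[OF assms(1,4,5,6)])
    show "p i + p 1 > 2 ^ n + 2" if i: "i \<in> {r + 1..s}" for i
    proof -
      have "p (r + 1) \<le> p i"
        using assms(5) i r(1) by (cases "i = r + 1") (auto simp: strict_mono_on_def intro!: less_imp_le)
      then show ?thesis using r(2) by simp
    qed
  qed (use r f assms(7) in auto)
  have large2: "real (p 1) > 2 powi (int n - 2) \<longleftrightarrow> 2 ^ n < 4 * p 1"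
    using powi_two_less_iff[of n 2 "p 1"] by simp
  have large3: "real (p 1) > 2 powi (int n - 3) \<longleftrightarrow> 2 ^ n < 8 * p 1"
    using powi_two_less_iff[of n 3 "p 1"] by simp
  have "\<not> (\<exists>f. generalized_bent m n f)"
    if "s = 1" and "real (p 1) > 2 powi (int n - 2)
         \<or> (\<not> mersenne_prime (p 1) \<and> real (p 1) > 2 powi (int n - 3))
         \<or> ([p 1 = 3] (mod 8) \<or> [p 1 = 5] (mod 8))"
  proof -
    have m: "m = 2 * p 1 ^ \<alpha> 1" using assms(7) that(1) by simp
    show ?thesis
      using that(2) no_gbf_large_prime[OF assms(2) p1] gbf_large_prime_mersenne[OF assms(2) p1]
        no_gbf_two_nonresidue[OF assms(2) p1 a1]
      unfolding m large2 large3 by blast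
  qed
  moreover have "\<not> (\<exists>f. generalized_bent m n f)"
    if "s \<ge> 2" "r \<le> s - 1" "p (r + 1) + p 1 > 2 ^ n + 2"
      "\<not> (\<exists>f. generalized_bent (2 * (\<Prod>i=1..r. p i ^ \<alpha> i)) n f)" for r
  proof -
    have "r < s" using that(1,2) by simp
    then show ?thesis using reduce that(3,4) by blast
  qed
  moreover have "\<not> (\<exists>f. generalized_bent m n f)"
    if "s \<ge> 2" "real (p 1) > 2 powi (int n - 2)" "p 1 + p 2 > 2 ^ n + 2"
  proof
    assume "\<exists>f. generalized_bent m n f"
    moreover have "p (1 + 1) + p 1 > 2 ^ n + 2" using that(3) by (simp add: add.commute numeral_2_eq_2)
    \<comment> \<open>Stopping at r = 1 leaves one prime power, which the large-prime bound
      excludes.\<close>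
    ultimately have "\<exists>f. generalized_bent (2 * p 1 ^ \<alpha> 1) n f"
      using reduce[of 1] that(1) by simp
    then show False using no_gbf_large_prime[OF assms(2) p1] that(2) unfolding large2 by blast
  qed
  ultimately show ?thesis by blast
qed

end
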